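(* In the setting of the context, consider the Riemann problem with two liquid states and assume the cavitation criterion is satisfied. If phase transition is admitted, this problem is always solvable.
   Context: Thermodynamics. Two phases (vapor $V$, liquid $L$) of one substance at a fixed temperature. For $K\in\{V,L\}$, $v_K(p)>0$ is the specific volume as a (at least $C^2$) function of the pressure $p$, with $p\in(0,\infty)$ for $K=V$ and $p\in[p_{min},\infty)$ for $K=L$, where $p_{min}\le 0$ is the minimum liquid pressure; $\rho=1/v$ is the density. The sound speed $a_K(p)>0$ is defined by $v_K'=-v_K^2/a_K^2$; the Gibbs energy satisfies $g_K'=v_K$; the saturation pressure $p_0>0$ satisfies $g_L(p_0)=g_V(p_0)$. $\gamma_K=\frac{a_K^2}{p v_K}$, $\mathcal G_K=1+\frac{a_K}{v_K}a_K'$, and $\mathcal G_K>0$ is assumed. $v_K(p)\to0$ as $p\to\infty$, and $v_V(p)\to\infty$ as $p\to0^+$. $\tau>0$ is a constant. There are constants $\alpha\in(0,1)$, $\beta>0$ such that, with $\sigma_{max}=\frac{1+\sqrt{11-6\alpha}}2$, uniformly for $p_V\in(0,\sigma_{max}p_0]$, $p_L\in[p_{min},\infty)$: $0<\frac{v_L(p_L)}{v_V(p_V)}\le\alpha$, $0<\frac{v_L(p_L)a_V(p_V)}{v_V(p_V)a_L(p_L)}\le\alpha\beta<1$, $\tau(1-\alpha)^2a_V(p_V)^3<\gamma_V(p_V)$. With $\varepsilon(\gamma_V)=\frac1{\gamma_V}-1-\frac{\tau a_V^3}{\gamma_V^2}(1-\alpha)^2(1-(\alpha\beta)^2)$, one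 of the following holds (for these $p_V$ and all $p_L>0$): (I) $\gamma_V\le1\le\gamma_L$ and $\frac1{\gamma_L}\ge1+\frac{\varepsilon(\gamma_V)}\alpha$; or (II) $\gamma_V<1$, $\gamma_L<1$, $\alpha\le\frac{1-1/\gamma_V}{1-1/\gamma_L}$ and $\varepsilon(\gamma_V)\le0$. Interface. $h(p_V,p_L)=\tau\bigl[g_L(p_L)-g_V(p_V)-\frac12(p_L-p_V)(v_L(p_L)+v_V(p_V))\bigr]$. For $p\in(0,\sigma_{max}p_0]$, $\varphi(p)$ denotes the unique liquid pressure $q$ with $q-p+(p\,h(p,q))^2(v_L(q)-v_V(p))=0$ and $-\frac{a_V(p)}{v_V(p)}\le p\,h(p,q)\le\frac{a_L(q)}{v_L(q)}$; $z(p)=p\,h(p,\varphi(p))$. Riemann problem. Isothermal Euler equations $\partial_t\rho+\partial_x(\rho u)=0$, $\partial_t(\rho u)+\partial_x(\rho u^2+p)=0$, with initial liquid states $\mathbf W_{L^-}=(\rho_{L^-},u_{L^-})$ for $x<0$ and $\mathbf W_{L^+}=(\rho_{L^+},u_{L^+})$ for $x>0$, of pressures $p_{L^\pm}\ge p_{min}$. Let $F_\pm(q)=\sqrt{-(q-p_{L^\pm})(v_L(q)-v_L(p_{L^\pm}))}$ if $q>p_{L^\pm}$ and $F_\pm(q)=\int_{p_{L^\pm}}^q\frac{v_L(\zeta)}{a_L(\zeta)}\mathrm d\zeta$ if $q\le p_{L^\pm}$. Cavitation criterion: $F_-(q)+F_+(q)+u_{L^+}-u_{L^-}$ has no root $q\ge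 p_{min}$ (no pure liquid solution). Across a discontinuity of speed $W$, with $[\![\Psi]\!]=\Psi^+-\Psi^-$ (right minus left) and $Z=-\rho(u-W)$: $[\![Z]\!]=0$, $-Z[\![u]\!]+[\![p]\!]=0$, and $Z[\![g+\tfrac12u^2]\!]\ge0$. A solution with phase transition is a self-similar solution consisting of constant states separated (left to right) by a classical wave (shock or rarefaction) in the liquid, a phase boundary, a phase boundary and a classical wave in the liquid, with a vapor state between the two phase boundaries. At a phase boundary with vapor on the left the mass flux is $Z=\tau p_V[\,g_L-g_V+\frac12u_L^2-\frac12u_V^2]$ and with liquid on the left it is $Z=-\tau p_V[\,g_L-g_V+\frac12u_L^2-\frac12u_V^2]$, where the adjacent states are inserted, and the quantity $\tau p_V[\cdots]$ lies in $[-a_V/v_V,a_L/v_L]$. Solvable means that such a solution exists; its vapor pressure corresponds to a root $p$ of $F_-(\varphi(p))+F_+(\varphi(p))+2z(p)(v_L(\varphi(p))-v_V(p))+u_{L^+}-u_{L^-}$.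
   Formalization: In the entropy inequality and the mass flux relation, the kinetic energy ½u² is taken relative to the discontinuity, ½(u−W)²; with laboratory velocities the claim fails (e.g. p_{L−}=p_min<0, u_− very negative) and does not match h and z. *)

theory Defs
  imports "HOL-Analysis.Analysis"
begin

datatype phase = Vapor | Liquid

text \<open>Specific volume, sound speed and Gibbs energy of each phase as functions of the pressure,
  minimum liquid pressure, saturation pressure, and the constant of the kinetic relation.\<close>

record two_phase_fluid =
  vol :: "phase \<Rightarrow> real \<Rightarrow> real"
  sound :: "phase \<Rightarrow> real \<Rightarrow> real"
  gibbs :: "phase \<Rightarrow> real \<Rightarrow> real"
  pmin :: real
  psat :: real
  tau :: real

fun dom_of :: "two_phase_fluid \<Rightarrow> phase \<Rightarrow> real set" where
  "dom_of M Vapor = {0<..}"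
| "dom_of M Liquid = {pmin M..}"

definition C2_on :: "real set \<Rightarrow> (real \<Rightarrow> real) \<Rightarrow> bool" where
  "C2_on S f \<longleftrightarrow> (\<exists>f' f''.
     (\<forall>x\<in>S. (f has_real_derivative f' x) (at x within S)) \<and>
     (\<forall>x\<in>S. (f' has_real_derivative f'' x) (at x within S)) \<and>
     continuous_on S f'')"

definition gam :: "two_phase_fluid \<Rightarrow> phase \<Rightarrow> real \<Rightarrow> real" where
  "gam M K p = (sound M K p)\<^sup>2 / (p * vol M K p)"

text \<open>The fundamental derivative \<open>1 + (a/v) a'\<close>; the derivative is one-sided at the left end
  of the liquid domain.\<close>

definition fundamental_derivative :: "two_phase_fluid \<Rightarrow> phase \<Rightarrow> real \<Rightarrow> real" where
  "fundamental_derivative M K p =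
     1 + sound M K p / vol M K p * vector_derivative (sound M K) (at p within dom_of M K)"

definition thermodynamics :: "two_phase_fluid \<Rightarrow> bool" where
  "thermodynamics M \<longleftrightarrow>
     pmin M \<le> 0 \<and> psat M > 0 \<and> tau M > 0 \<and>
     gibbs M Liquid (psat M) = gibbs M Vapor (psat M) \<and>
     (\<forall>K. C2_on (dom_of M K) (vol M K)) \<and>
     (\<forall>K. \<forall>p\<in>dom_of M K.
        vol M K p > 0 \<and> sound M K p > 0 \<and>
        (vol M K has_real_derivative - ((vol M K p)\<^sup>2 / (sound M K p)\<^sup>2)) (at p within dom_of M K) \<and>
        (gibbs M K has_real_derivative vol M K p) (at p within dom_of M K) \<and>
        fundamental_derivative M K p > 0) \<and>
     (\<forall>K. (vol M K \<longlongrightarrow> 0) at_top) \<and>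
     filterlim (vol M Vapor) at_top (at_right 0)"

definition sigma_max :: "real \<Rightarrow> real" where
  "sigma_max \<alpha> = (1 + sqrt (11 - 6 * \<alpha>)) / 2"

definition epsilon :: "two_phase_fluid \<Rightarrow> real \<Rightarrow> real \<Rightarrow> real \<Rightarrow> real" where
  "epsilon M \<alpha> \<beta> pV =
     1 / gam M Vapor pV - 1
     - tau M * (sound M Vapor pV) ^ 3 / (gam M Vapor pV)\<^sup>2 * (1 - \<alpha>)\<^sup>2 * (1 - (\<alpha> * \<beta>)\<^sup>2)"

text \<open>The alternative between the two cases is imposed pointwise in the two pressures, which is
  implied by either case holding for all of them.\<close>

definition structural_assumptions :: "two_phase_fluid \<Rightarrow> real \<Rightarrow> real \<Rightarrow> bool" where
  "structural_assumptions M \<alpha> \<beta> \<longleftrightarrow>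
     0 < \<alpha> \<and> \<alpha> < 1 \<and> 0 < \<beta> \<and> \<alpha> * \<beta> < 1 \<and>
     (\<forall>pV pL. 0 < pV \<and> pV \<le> sigma_max \<alpha> * psat M \<and> pmin M \<le> pL \<longrightarrow>
        0 < vol M Liquid pL / vol M Vapor pV \<and>
        vol M Liquid pL / vol M Vapor pV \<le> \<alpha> \<and>
        0 < (vol M Liquid pL * sound M Vapor pV) / (vol M Vapor pV * sound M Liquid pL) \<and>
        (vol M Liquid pL * sound M Vapor pV) / (vol M Vapor pV * sound M Liquid pL) \<le> \<alpha> * \<beta> \<and>
        tau M * (1 - \<alpha>)\<^sup>2 * (sound M Vapor pV) ^ 3 < gam M Vapor pV) \<and>
     (\<forall>pV pL. 0 < pV \<and> pV \<le> sigma_max \<alpha> * psat M \<and> 0 < pL \<longrightarrow>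
        (gam M Vapor pV \<le> 1 \<and> 1 \<le> gam M Liquid pL \<and>
         1 / gam M Liquid pL \<ge> 1 + epsilon M \<alpha> \<beta> pV / \<alpha>) \<or>
        (gam M Vapor pV < 1 \<and> gam M Liquid pL < 1 \<and>
         \<alpha> \<le> (1 - 1 / gam M Vapor pV) / (1 - 1 / gam M Liquid pL) \<and>
         epsilon M \<alpha> \<beta> pV \<le> 0))"

definition h_fun :: "two_phase_fluid \<Rightarrow> real \<Rightarrow> real \<Rightarrow> real" where
  "h_fun M pV pL = tau M * (gibbs M Liquid pL - gibbs M Vapor pV
     - (pL - pV) * (vol M Liquid pL + vol M Vapor pV) / 2)"

definition interface_pressure :: "two_phase_fluid \<Rightarrow> real \<Rightarrow> real \<Rightarrow> bool" where
  "interface_pressure M p q \<longleftrightarrow>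
     pmin M \<le> q \<and>
     q - p + (p * h_fun M p q)\<^sup>2 * (vol M Liquid q - vol M Vapor p) = 0 \<and>
     - (sound M Vapor p / vol M Vapor p) \<le> p * h_fun M p q \<and>
     p * h_fun M p q \<le> sound M Liquid q / vol M Liquid q"

definition phi :: "two_phase_fluid \<Rightarrow> real \<Rightarrow> real" where
  "phi M p = (THE q. interface_pressure M p q)"

definition z_fun :: "two_phase_fluid \<Rightarrow> real \<Rightarrow> real" where
  "z_fun M p = p * h_fun M p (phi M p)"

text \<open>The wave function of a liquid initial state of pressure \<open>pK\<close>. For \<open>q \<le> pK\<close> the oriented
  integral from \<open>pK\<close> to \<open>q\<close> is minus the integral over the interval from \<open>q\<close> to \<open>pK\<close>.\<close>

definition wave_fun :: "two_phase_fluid \<Rightarrow> real \<Rightarrow> real \<Rightarrow> real" where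
  "wave_fun M pK q =
     (if q > pK then sqrt (- ((q - pK) * (vol M Liquid q - vol M Liquid pK)))
      else - integral {q..pK} (\<lambda>\<zeta>. vol M Liquid \<zeta> / sound M Liquid \<zeta>))"

definition cavitation_criterion ::
    "two_phase_fluid \<Rightarrow> real \<Rightarrow> real \<Rightarrow> real \<Rightarrow> real \<Rightarrow> bool" where
  "cavitation_criterion M pm um pp up \<longleftrightarrow>
     \<not> (\<exists>q\<ge>pmin M. wave_fun M pm q + wave_fun M pp q + up - um = 0)"

definition transition_fun ::
    "two_phase_fluid \<Rightarrow> real \<Rightarrow> real \<Rightarrow> real \<Rightarrow> real \<Rightarrow> real \<Rightarrow> real" where
  "transition_fun M pm um pp up p =
     wave_fun M pm (phi M p) + wave_fun M pp (phi M p)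
     + 2 * z_fun M p * (vol M Liquid (phi M p) - vol M Vapor p) + up - um"

text \<open>A state is a phase, a pressure and a velocity; since the specific volume is strictly
  monotone in the pressure, this is the same as a phase, a density and a velocity.\<close>

type_synonym state = "phase \<times> real \<times> real"

fun phase_of :: "state \<Rightarrow> phase" where "phase_of (K, p, u) = K"
fun pres :: "state \<Rightarrow> real" where "pres (K, p, u) = p"
fun vel :: "state \<Rightarrow> real" where "vel (K, p, u) = u"
fun density :: "two_phase_fluid \<Rightarrow> state \<Rightarrow> real" where "density M (K, p, u) = 1 / vol M K p"

definition is_state :: "two_phase_fluid \<Rightarrow> phase \<Rightarrow> state \<Rightarrow> bool" where
  "is_state M K A \<longleftrightarrow> phase_of A = K \<and> pres A \<in> dom_of M K"

text \<open>Mass flux \<open>Z\<close> through, and Gibbs plus kinetic energy relative to, a front of speed \<open>W\<close>.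
  The kinetic energy in the entropy inequality and in the kinetic relation is the one in the rest
  frame of the front: only this is Galilean invariant, and only this turns the kinetic relation
  into \<open>p h(p, q)\<close> by means of the jump conditions.\<close>

definition mass_flux :: "two_phase_fluid \<Rightarrow> real \<Rightarrow> state \<Rightarrow> real" where
  "mass_flux M W A = - (density M A * (vel A - W))"

definition front_energy :: "two_phase_fluid \<Rightarrow> real \<Rightarrow> state \<Rightarrow> real" where
  "front_energy M W A = gibbs M (phase_of A) (pres A) + (vel A - W)\<^sup>2 / 2"

text \<open>Jump conditions and entropy inequality at a front of speed \<open>W\<close> with \<open>A\<close> on the left
  and \<open>B\<close> on the right.\<close>

definition jump_conditions :: "two_phase_fluid \<Rightarrow> real \<Rightarrow> state \<Rightarrow> state \<Rightarrow> bool" where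
  "jump_conditions M W A B \<longleftrightarrow>
     mass_flux M W B - mass_flux M W A = 0 \<and>
     - mass_flux M W A * (vel B - vel A) + (pres B - pres A) = 0 \<and>
     mass_flux M W A * (front_energy M W B - front_energy M W A) \<ge> 0"

text \<open>A profile \<open>U\<close> is a function of the similarity variable; it stands for the field
  \<open>(t, x) \<mapsto> U (x / t)\<close> for \<open>t > 0\<close>. The isothermal Euler equations hold classically at
  \<open>(t, x)\<close>:\<close>

definition euler_at :: "two_phase_fluid \<Rightarrow> (real \<Rightarrow> state) \<Rightarrow> real \<Rightarrow> real \<Rightarrow> bool" where
  "euler_at M U t x \<longleftrightarrow>
     (let \<rho> = (\<lambda>t x. density M (U (x / t)));
          u = (\<lambda>t x. vel (U (x / t)));
          p = (\<lambda>t x. pres (U (x / t)))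
      in \<exists>\<rho>_t m_x m_t i_x.
           ((\<lambda>s. \<rho> s x) has_real_derivative \<rho>_t) (at t) \<and>
           ((\<lambda>y. \<rho> t y * u t y) has_real_derivative m_x) (at x) \<and>
           ((\<lambda>s. \<rho> s x * u s x) has_real_derivative m_t) (at t) \<and>
           ((\<lambda>y. \<rho> t y * (u t y)\<^sup>2 + p t y) has_real_derivative i_x) (at x) \<and>
           \<rho>_t + m_x = 0 \<and> m_t + i_x = 0)"

definition liquid_rarefaction ::
    "two_phase_fluid \<Rightarrow> (real \<Rightarrow> state) \<Rightarrow> real \<Rightarrow> real \<Rightarrow> state \<Rightarrow> state \<Rightarrow> bool" where
  "liquid_rarefaction M U s1 s2 A B \<longleftrightarrow>
     s1 < s2 \<and> U s1 = A \<and> U s2 = B \<and>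
     (\<forall>\<xi>\<in>{s1..s2}. is_state M Liquid (U \<xi>)) \<and>
     continuous_on {s1..s2} (\<lambda>\<xi>. pres (U \<xi>)) \<and>
     continuous_on {s1..s2} (\<lambda>\<xi>. vel (U \<xi>)) \<and>
     (\<forall>t x. t > 0 \<and> s1 < x / t \<and> x / t < s2 \<longrightarrow> euler_at M U t x)"

text \<open>A shock, for which the two ends of the wave coincide, or a rarefaction. The case \<open>A = B\<close>
  is the wave of strength zero, which occurs if the pressure at the interface equals the one of the
  initial state.\<close>

definition classical_wave ::
    "two_phase_fluid \<Rightarrow> (real \<Rightarrow> state) \<Rightarrow> real \<Rightarrow> real \<Rightarrow> state \<Rightarrow> state \<Rightarrow> bool" where
  "classical_wave M U s1 s2 A B \<longleftrightarrow>
     is_state M Liquid A \<and> is_state M Liquid B \<and>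
     ((s1 = s2 \<and> jump_conditions M s1 A B) \<or> liquid_rarefaction M U s1 s2 A B)"

definition transition_rate :: "two_phase_fluid \<Rightarrow> real \<Rightarrow> state \<Rightarrow> state \<Rightarrow> real" where
  "transition_rate M W V L = tau M * pres V * (front_energy M W L - front_energy M W V)"

definition rate_admissible :: "two_phase_fluid \<Rightarrow> real \<Rightarrow> state \<Rightarrow> state \<Rightarrow> bool" where
  "rate_admissible M W V L \<longleftrightarrow>
     - (sound M Vapor (pres V) / vol M Vapor (pres V)) \<le> transition_rate M W V L \<and>
     transition_rate M W V L \<le> sound M Liquid (pres L) / vol M Liquid (pres L)"

definition vapor_liquid_boundary :: "two_phase_fluid \<Rightarrow> real \<Rightarrow> state \<Rightarrow> state \<Rightarrow> bool" where
  "vapor_liquid_boundary M W V L \<longleftrightarrow>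
     is_state M Vapor V \<and> is_state M Liquid L \<and> jump_conditions M W V L \<and>
     mass_flux M W V = transition_rate M W V L \<and> rate_admissible M W V L"

definition liquid_vapor_boundary :: "two_phase_fluid \<Rightarrow> real \<Rightarrow> state \<Rightarrow> state \<Rightarrow> bool" where
  "liquid_vapor_boundary M W L V \<longleftrightarrow>
     is_state M Liquid L \<and> is_state M Vapor V \<and> jump_conditions M W L V \<and>
     mass_flux M W L = - transition_rate M W V L \<and> rate_admissible M W V L"

text \<open>\<open>A\<close> and \<open>B\<close> are the initial states for \<open>x < 0\<close> and \<open>x > 0\<close>, \<open>V\<close> is the vapor state.
  The values at the fronts themselves are irrelevant.\<close>

definition phase_transition_solution ::
    "two_phase_fluid \<Rightarrow> (real \<Rightarrow> state) \<Rightarrow> state \<Rightarrow> state \<Rightarrow> state \<Rightarrow> bool" where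
  "phase_transition_solution M U A V B \<longleftrightarrow>
     (\<exists>s1 s2 w1 w2 s3 s4 L R.
        s1 \<le> s2 \<and> s2 < w1 \<and> w1 < w2 \<and> w2 < s3 \<and> s3 \<le> s4 \<and>
        (\<forall>\<xi>. \<xi> < s1 \<longrightarrow> U \<xi> = A) \<and>
        classical_wave M U s1 s2 A L \<and>
        (\<forall>\<xi>. s2 < \<xi> \<and> \<xi> < w1 \<longrightarrow> U \<xi> = L) \<and>
        liquid_vapor_boundary M w1 L V \<and>
        (\<forall>\<xi>. w1 < \<xi> \<and> \<xi> < w2 \<longrightarrow> U \<xi> = V) \<and>
        vapor_liquid_boundary M w2 V R \<and>
        (\<forall>\<xi>. w2 < \<xi> \<and> \<xi> < s3 \<longrightarrow> U \<xi> = R) \<and>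
        classical_wave M U s3 s4 R B \<and>
        (\<forall>\<xi>. s4 < \<xi> \<longrightarrow> U \<xi> = B))"

end

theory Submission
  imports Defs
begin

text \<open>For \<open>p \<le> p\<^sub>0\<close> the interface equation has a branch \<open>q = \<phi>(p) \<ge> p\<close> with \<open>z \<ge> 0\<close>, namely the root
  of \<open>p h(p, q) = sqrt ((q - p) / (v\<^sub>V(p) - v\<^sub>L(q)))\<close>: convexity of \<open>v\<^sub>L\<close> and \<open>v\<^sub>L < v\<^sub>V(p)\<close> make
  the left side strictly decreasing and the right side increasing in \<open>q\<close>, so the root is unique and
  continuous in \<open>p\<close>. The same convexity shows that \<open>z\<close> is below the liquid sonic flux and below the
  flux of any liquid shock ending at \<open>q\<close>, so both the bound on the rate and the ordering of the
  waves are automatic.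

  Along this branch the transition function is
  \<open>F\<^sub>-(q) + F\<^sub>+(q) + u\<^sub>+ - u\<^sub>- - 2 sqrt ((q - p) (v\<^sub>V(p) - v\<^sub>L(q)))\<close>. At \<open>p = p\<^sub>0\<close> the square root
  vanishes, and the rest is positive: it tends to infinity with \<open>q\<close> and has no zero by the
  cavitation criterion. As \<open>p\<close> tends to 0 the square root is unbounded and dominates \<open>F\<^sub>-\<close> and \<open>F\<^sub>+\<close>.
  A zero in between gives a solution with \<open>z > 0\<close>. The left half of the wave pattern is the
  mirror image of a right half.\<close>

section \<open>Convexity of the specific volume\<close>

lemma dom_of_upward: "p \<in> dom_of M K \<Longrightarrow> p \<le> q \<Longrightarrow> q \<in> dom_of M K"
  by (cases K) auto

text \<open>The domains are closed upward, so they contain right neighborhoods of their points. This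
  makes derivatives within the domain unique, also at \<open>pmin M\<close>.\<close>

lemma at_within_dom_of_neq_bot:
  assumes "p \<in> dom_of M K"
  shows "at p within dom_of M K \<noteq> bot"
proof -
  have "at_right p \<le> at p within dom_of M K"
    using assms dom_of_upward by (intro at_le) (auto intro: less_imp_le)
  then show ?thesis
    using trivial_limit_at_right_real[of p] by (auto simp: bot_unique)
qed

text \<open>At \<open>pmin M\<close> only a one-sided derivative is given; restricting it to
  \<open>{p..q}\<close> suffices for the mean value theorem.\<close>

lemma mvt_dom_of:
  assumes "p \<in> dom_of M K" "p < q"
    and "\<And>x. p \<le> x \<Longrightarrow> x \<le> q \<Longrightarrow> (f has_real_derivative f' x) (at x within dom_of M K)"
  obtains x where "p < x" "x < q" "f q - f p = f' x * (q - p)"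
proof -
  have "\<exists>x\<in>{p<..<q}. f q - f p = (\<lambda>h. f' x * h) (q - p)"
  proof (rule mvt_simple[OF assms(2)])
    fix x assume "p \<le> x" "x \<le> q"
    then show "(f has_derivative (\<lambda>h. f' x * h)) (at x within {p..q})"
      using assms(1) dom_of_upward
      by (intro has_field_derivative_imp_has_derivative[OF has_field_derivative_subset[OF assms(3)]])
         auto
  qed
  then show ?thesis using that by auto
qed

locale fluid =
  fixes M :: two_phase_fluid
  assumes thermo: "thermodynamics M"
begin

abbreviation "v\<^sub>L \<equiv> vol M Liquid"
abbreviation "v\<^sub>V \<equiv> vol M Vapor"
abbreviation "g\<^sub>L \<equiv> gibbs M Liquid"
abbreviation "g\<^sub>V \<equiv> gibbs M Vapor"

definition dvol :: "phase \<Rightarrow> real \<Rightarrow> real" where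
  "dvol K p = - ((vol M K p)\<^sup>2 / (sound M K p)\<^sup>2)"

lemma pmin_nonpos: "pmin M \<le> 0" and psat_pos: "psat M > 0" and tau_pos: "tau M > 0"
  and gibbs_psat: "g\<^sub>L (psat M) = g\<^sub>V (psat M)"
  and vol_C2: "C2_on (dom_of M K) (vol M K)"
  and vol_vapor_at_top: "filterlim v\<^sub>V at_top (at_right 0)"
  using thermo by (auto simp: thermodynamics_def)

lemma
  assumes "p \<in> dom_of M K"
  shows vol_pos: "vol M K p > 0" and sound_pos: "sound M K p > 0"
    and vol_deriv: "(vol M K has_real_derivative dvol K p) (at p within dom_of M K)"
    and gibbs_deriv: "(gibbs M K has_real_derivative vol M K p) (at p within dom_of M K)"
    and fundamental_derivative_pos: "fundamental_derivative M K p > 0"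
  using thermo assms by (auto simp: thermodynamics_def dvol_def)

lemma pos_in_dom_of: "p > 0 \<Longrightarrow> p \<in> dom_of M K"
  using pmin_nonpos by (cases K) auto

lemma pos_ge_pmin: "p > 0 \<Longrightarrow> pmin M \<le> p"
  using pmin_nonpos by simp

lemma dvol_neg: "p \<in> dom_of M K \<Longrightarrow> dvol K p < 0"
  using vol_pos[of p K] sound_pos[of p K] by (simp add: dvol_def)

lemma sqrt_dvol: "p \<in> dom_of M K \<Longrightarrow> sqrt (- dvol K p) = vol M K p / sound M K p"
  using vol_pos[of p K] sound_pos[of p K] by (simp add: dvol_def real_sqrt_divide)

text \<open>\<open>C2_on\<close> only supplies some first derivative; uniqueness of derivatives
  within the domain identifies it with \<open>dvol\<close>.\<close>

lemma dvol_differentiable: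
  assumes "p \<in> dom_of M K"
  shows "\<exists>d. (dvol K has_real_derivative d) (at p within dom_of M K)"
proof -
  obtain f' f'' where f':
      "\<And>x. x \<in> dom_of M K \<Longrightarrow> (vol M K has_real_derivative f' x) (at x within dom_of M K)"
    and f'': "\<And>x. x \<in> dom_of M K \<Longrightarrow> (f' has_real_derivative f'' x) (at x within dom_of M K)"
    using vol_C2[of K] unfolding C2_on_def by blast
  have "f' x = dvol K x" if "x \<in> dom_of M K" for x
    using vector_derivative_unique_within[OF at_within_dom_of_neq_bot[OF that]]
      f'[OF that] vol_deriv[OF that] by (simp add: has_real_derivative_iff_has_vector_derivative)
  then show ?thesis
    using has_field_derivative_transform_within[OF f''[OF assms] zero_less_one assms] by blast
qed

text \<open>Differentiability of the sound speed comes from that of \<open>dvol\<close> through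
  \<open>a = v / sqrt (- v')\<close>. With it the \<open>vector_derivative\<close> in
  \<open>fundamental_derivative\<close> is known to be an actual derivative.\<close>

lemma sound_deriv:
  assumes "p \<in> dom_of M K"
  obtains d where "(sound M K has_real_derivative d) (at p within dom_of M K)"
    and "1 + sound M K p / vol M K p * d > 0"
proof -
  have eq: "sound M K x = vol M K x / sqrt (- dvol K x)" if "x \<in> dom_of M K" for x
    unfolding sqrt_dvol[OF that] using vol_pos[OF that] sound_pos[OF that] by simp
  obtain e where "(dvol K has_real_derivative e) (at p within dom_of M K)"
    using dvol_differentiable[OF assms] by blast
  then have "((\<lambda>x. sqrt (- dvol K x)) has_real_derivative inverse (sqrt (- dvol K p)) / 2 * - e)
      (at p within dom_of M K)"
    using dvol_neg[OF assms] by (intro DERIV_chain2[OF DERIV_real_sqrt] DERIV_minus) auto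
  from DERIV_divide[OF vol_deriv[OF assms] this] dvol_neg[OF assms]
  have "\<exists>d. ((\<lambda>x. vol M K x / sqrt (- dvol K x)) has_real_derivative d) (at p within dom_of M K)"
    by auto
  then obtain d where "((\<lambda>x. vol M K x / sqrt (- dvol K x)) has_real_derivative d) (at p within dom_of M K)"
    by blast
  then have d: "(sound M K has_real_derivative d) (at p within dom_of M K)"
    by (rule has_field_derivative_transform_within[OF _ zero_less_one assms]) (simp add: eq)
  then have "vector_derivative (sound M K) (at p within dom_of M K) = d"
    by (intro vector_derivative_within[OF at_within_dom_of_neq_bot[OF assms]])
       (simp add: has_real_derivative_iff_has_vector_derivative)
  then show ?thesis
    using that d fundamental_derivative_pos[OF assms] by (simp add: fundamental_derivative_def)
qed

text \<open>Positivity of the fundamental derivative is strict convexity of the volume in the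
  pressure: \<open>v'' = (2 v\<^sup>3 / a\<^sup>4) (1 + a a' / v)\<close>.\<close>

lemma dvol_deriv_pos:
  assumes "p \<in> dom_of M K"
  obtains e where "(dvol K has_real_derivative e) (at p within dom_of M K)" "e > 0"
proof -
  obtain d where d: "(sound M K has_real_derivative d) (at p within dom_of M K)"
    and G: "1 + sound M K p / vol M K p * d > 0"
    by (rule sound_deriv[OF assms])
  define v a where "v = vol M K p" and "a = sound M K p"
  have va: "v > 0" "a > 0" using vol_pos[OF assms] sound_pos[OF assms] by (auto simp: v_def a_def)
  have "((\<lambda>x. - ((vol M K x)\<^sup>2 / (sound M K x)\<^sup>2)) has_real_derivative
      2 * v ^ 3 / a ^ 4 * (1 + a / v * d)) (at p within dom_of M K)"
    using d vol_deriv[OF assms] va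
    by (auto intro!: derivative_eq_intros simp: dvol_def simp flip: v_def a_def)
       (simp add: field_simps eval_nat_numeral)
  moreover have "2 * v ^ 3 / a ^ 4 * (1 + a / v * d) > 0"
    using va G by (simp add: v_def a_def)
  ultimately show ?thesis
    using that by (simp add: dvol_def[abs_def])
qed

section \<open>Monotonicity and convexity inequalities\<close>

lemma vol_strict_antimono:
  assumes "p \<in> dom_of M K" "p < q"
  shows "vol M K q < vol M K p"
proof -
  obtain x where "p < x" and x: "vol M K q - vol M K p = dvol K x * (q - p)"
    using mvt_dom_of[OF assms] vol_deriv dom_of_upward[OF assms(1)] by metis
  then have "dvol K x < 0" using dvol_neg dom_of_upward[OF assms(1)] by simp
  then have "dvol K x * (q - p) < 0" using assms(2) by (simp add: mult_neg_pos)
  then show ?thesis using x by linarith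
qed

lemma vol_antimono: "p \<in> dom_of M K \<Longrightarrow> p \<le> q \<Longrightarrow> vol M K q \<le> vol M K p"
  using vol_strict_antimono[of p K q] by (cases "p = q") auto

lemma dvol_strict_mono:
  assumes "p \<in> dom_of M K" "p < q"
  shows "dvol K p < dvol K q"
proof -
  have "\<exists>e. (dvol K has_real_derivative e) (at x within dom_of M K) \<and> e > 0" if "p \<le> x" for x
    using dvol_deriv_pos dom_of_upward[OF assms(1) that] by metis
  then obtain e where e: "\<And>x. p \<le> x \<Longrightarrow> (dvol K has_real_derivative e x) (at x within dom_of M K)"
    "\<And>x. p \<le> x \<Longrightarrow> e x > 0" by metis
  obtain x where "p < x" and x: "dvol K q - dvol K p = e x * (q - p)"
    using mvt_dom_of[OF assms] e(1) by metis
  then have "dvol K q - dvol K p > 0" using e(2)[of x] assms(2) by simp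
  then show ?thesis by simp
qed

text \<open>The slope of the chord is \<open>dvol\<close> at an interior point, and
  \<open>dvol\<close> is strictly increasing.\<close>

lemma vol_chord_less_tangent:
  assumes "p \<in> dom_of M K" "p < q"
  shows "vol M K q - vol M K p < dvol K q * (q - p)"
    and "dvol K p * (q - p) < vol M K q - vol M K p"
proof -
  obtain x where "p < x" "x < q" and x: "vol M K q - vol M K p = dvol K x * (q - p)"
    using mvt_dom_of[OF assms] vol_deriv dom_of_upward[OF assms(1)] by metis
  then show "vol M K q - vol M K p < dvol K q * (q - p)"
    "dvol K p * (q - p) < vol M K q - vol M K p"
    using dvol_strict_mono[of x K q] dvol_strict_mono[of p K x] assms dom_of_upward[OF assms(1)]
    by (auto intro!: mult_strict_right_mono)
qed

text \<open>The slope of the tangent at the middle point \<open>q\<close> separates the slopes of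
  the two chords. The form without division admits \<open>p = q\<close>.\<close>

lemma vol_three_points:
  assumes "p \<in> dom_of M K" "p \<le> q" "q < r"
  shows "(q - p) * (vol M K q - vol M K r) \<le> (r - q) * (vol M K p - vol M K q)"
proof (cases "p = q")
  case False
  then have pq: "p < q" using assms by simp
  have "(q - p) * (vol M K q - vol M K r) \<le> (q - p) * (- dvol K q * (r - q))"
    using vol_chord_less_tangent(2)[of q K r] dom_of_upward[OF assms(1,2)] assms
    by (intro mult_left_mono) auto
  also have "\<dots> = (r - q) * (- dvol K q * (q - p))" by simp
  also have "\<dots> \<le> (r - q) * (vol M K p - vol M K q)"
    using vol_chord_less_tangent(1)[OF assms(1) pq] assms by (intro mult_left_mono) auto
  finally show ?thesis .
qed simp

text \<open>The trapezoidal rule overestimates the integral of the convex function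
  \<open>vol M K\<close>. This is the source of the entropy inequality for liquid shocks.\<close>

lemma gibbs_trapezoid:
  assumes "p \<in> dom_of M K" "p < q"
  shows "gibbs M K q - gibbs M K p \<le> (q - p) * (vol M K p + vol M K q) / 2"
proof -
  let ?f = "\<lambda>x. gibbs M K x - (x - p) * (vol M K p + vol M K x) / 2"
  have "(?f has_real_derivative (vol M K x - vol M K p - (x - p) * dvol K x) / 2)
      (at x within dom_of M K)" if "p \<le> x" for x
    using vol_deriv[OF dom_of_upward[OF assms(1) that]] gibbs_deriv[OF dom_of_upward[OF assms(1) that]]
    by (auto intro!: derivative_eq_intros simp: field_simps)
  from mvt_dom_of[OF assms this] obtain x where "p < x"
    and x: "?f q - ?f p = (vol M K x - vol M K p - (x - p) * dvol K x) / 2 * (q - p)" by metis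
  have "?f q - ?f p \<le> 0"
    unfolding x using vol_chord_less_tangent(1)[OF assms(1) \<open>p < x\<close>] assms
    by (intro mult_nonpos_nonneg) (auto simp: algebra_simps)
  then show ?thesis by simp
qed

section \<open>Continuity of the constitutive functions\<close>

lemma continuous_on_vol: "continuous_on (dom_of M K) (vol M K)"
  and continuous_on_gibbs: "continuous_on (dom_of M K) (gibbs M K)"
  unfolding continuous_on_eq_continuous_within
  using vol_deriv[THEN DERIV_continuous] gibbs_deriv[THEN DERIV_continuous] by auto

lemma continuous_on_sound: "continuous_on (dom_of M K) (sound M K)"
  unfolding continuous_on_eq_continuous_within
proof
  fix p assume "p \<in> dom_of M K"
  then show "continuous (at p within dom_of M K) (sound M K)"
    by (rule sound_deriv) (rule DERIV_continuous)
qed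

end

section \<open>The evaporation branch of the interface equation\<close>

locale structured_fluid = fluid +
  fixes \<alpha> \<beta> :: real
  assumes structural: "structural_assumptions M \<alpha> \<beta>"
begin

text \<open>Since \<alpha> < 1, the square root in \<open>sigma_max\<close> exceeds 1. Hence the
  structural assumptions apply at every positive vapor pressure up to \<open>psat M\<close>.\<close>

lemma le_psat_imp_le_sigma_max:
  assumes "p \<le> psat M"
  shows "p \<le> sigma_max \<alpha> * psat M"
proof -
  have "sqrt 1 \<le> sqrt (11 - 6 * \<alpha>)"
    using structural by (intro real_sqrt_le_mono) (simp add: structural_assumptions_def)
  then have "1 \<le> sigma_max \<alpha>" by (simp add: sigma_max_def)
  then have "1 * psat M \<le> sigma_max \<alpha> * psat M"
    using psat_pos by (intro mult_right_mono) auto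
  then show ?thesis using assms by simp
qed

lemma vol_liquid_less_vapor:
  assumes "0 < p" "p \<le> psat M" "pmin M \<le> q"
  shows "v\<^sub>L q < v\<^sub>V p"
proof -
  have "v\<^sub>L q / v\<^sub>V p \<le> \<alpha>" "\<alpha> < 1"
    using structural assms(1,3) le_psat_imp_le_sigma_max[OF assms(2)]
    unfolding structural_assumptions_def by blast+
  then have "v\<^sub>L q / v\<^sub>V p < 1" by simp
  then show ?thesis using vol_pos[of p Vapor] assms by simp
qed

text \<open>Both alternatives of the structural assumptions contain this bound.\<close>

lemma gam_vapor_le_1:
  assumes "0 < p" "p \<le> psat M"
  shows "gam M Vapor p \<le> 1"
proof -
  have "\<forall>pV (pL::real). 0 < pV \<and> pV \<le> sigma_max \<alpha> * psat M \<and> 0 < pL \<longrightarrow>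
      gam M Vapor pV \<le> 1"
    using structural unfolding structural_assumptions_def by (meson less_imp_le)
  \<comment> \<open>The alternatives also quantify over a positive liquid pressure; 1 is an
    arbitrary choice.\<close>
  from this[rule_format, of p 1] show ?thesis
    using assms(1) le_psat_imp_le_sigma_max[OF assms(2)] by simp
qed

text \<open>The square root of the interface equation on the branch \<open>q \<ge> p\<close>, \<open>h \<ge> 0\<close>, where, unlike the
  equation itself, it is a difference of monotone functions of \<open>q\<close>.\<close>

definition interface_defect :: "real \<Rightarrow> real \<Rightarrow> real" where
  "interface_defect p q = p * h_fun M p q - sqrt ((q - p) / (v\<^sub>V p - v\<^sub>L q))"

text \<open>Up to the factor \<open>tau M / 2\<close>, the derivative in the liquid pressure
  \<open>x\<close> is \<open>v\<^sub>L x - v\<^sub>V p - (x - p) * dvol Liquid x\<close>. By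
  convexity it is below \<open>v\<^sub>L p - v\<^sub>V p\<close>, which is negative.\<close>

lemma h_fun_strict_antimono:
  assumes p: "0 < p" "p \<le> psat M" and q: "p \<le> q" "q < r"
  shows "h_fun M p r < h_fun M p q"
proof -
  have q_dom: "q \<in> dom_of M Liquid" using p q by (intro pos_in_dom_of) simp
  have "((\<lambda>q. h_fun M p q) has_real_derivative
      tau M / 2 * (v\<^sub>L x - v\<^sub>V p - (x - p) * dvol Liquid x)) (at x within dom_of M Liquid)"
    if "q \<le> x" for x
    unfolding h_fun_def
    using vol_deriv[OF dom_of_upward[OF q_dom that]] gibbs_deriv[OF dom_of_upward[OF q_dom that]]
    by (auto intro!: derivative_eq_intros simp: field_simps)
  from mvt_dom_of[OF q_dom q(2) this] obtain x where x: "q < x"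
    and eq: "h_fun M p r - h_fun M p q =
      tau M / 2 * (v\<^sub>L x - v\<^sub>V p - (x - p) * dvol Liquid x) * (r - q)" by metis
  have "v\<^sub>L x - v\<^sub>L p < dvol Liquid x * (x - p)"
    using p q x by (intro vol_chord_less_tangent pos_in_dom_of) auto
  moreover have "v\<^sub>L p < v\<^sub>V p" using vol_liquid_less_vapor p pmin_nonpos by simp
  ultimately have "v\<^sub>L x - v\<^sub>V p - (x - p) * dvol Liquid x < 0" by (simp add: algebra_simps)
  then have "tau M / 2 * (v\<^sub>L x - v\<^sub>V p - (x - p) * dvol Liquid x) * (r - q) < 0"
    using q tau_pos by (intro mult_neg_pos mult_pos_neg) auto
  then show ?thesis using eq by simp
qed

text \<open>The radicand increases weakly by the three-point inequality, in which
  \<open>v\<^sub>L p\<close> is replaced by the larger \<open>v\<^sub>V p\<close>; strictness comes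
  from \<open>h_fun\<close>.\<close>

lemma interface_defect_strict_antimono:
  assumes p: "0 < p" "p \<le> psat M" and q: "p \<le> q" "q < r"
  shows "interface_defect p r < interface_defect p q"
proof -
  have less: "v\<^sub>L q < v\<^sub>V p" "v\<^sub>L r < v\<^sub>V p"
    using vol_liquid_less_vapor p q pmin_nonpos by auto
  have "(q - p) * (v\<^sub>L q - v\<^sub>L r) \<le> (r - q) * (v\<^sub>L p - v\<^sub>L q)"
    using vol_three_points[OF pos_in_dom_of[OF p(1)] q] .
  also have "\<dots> \<le> (r - q) * (v\<^sub>V p - v\<^sub>L q)"
    using vol_liquid_less_vapor[of p p] p q pmin_nonpos by (intro mult_left_mono) auto
  finally have "(q - p) * (v\<^sub>V p - v\<^sub>L r) \<le> (r - p) * (v\<^sub>V p - v\<^sub>L q)"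
    by (simp add: algebra_simps)
  then have "(q - p) / (v\<^sub>V p - v\<^sub>L q) \<le> (r - p) / (v\<^sub>V p - v\<^sub>L r)"
    using less by (simp add: divide_simps mult.commute)
  then have "sqrt ((q - p) / (v\<^sub>V p - v\<^sub>L q)) \<le> sqrt ((r - p) / (v\<^sub>V p - v\<^sub>L r))"
    by (rule real_sqrt_le_mono)
  moreover have "p * h_fun M p r < p * h_fun M p q"
    using h_fun_strict_antimono[OF p q] p by simp
  ultimately show ?thesis
    unfolding interface_defect_def by linarith
qed

lemma interface_defect_self: "interface_defect p p = tau M * p * (g\<^sub>L p - g\<^sub>V p)"
  by (simp add: interface_defect_def h_fun_def)

text \<open>\<open>g\<^sub>L - g\<^sub>V\<close> has the negative derivative
  \<open>v\<^sub>L - v\<^sub>V\<close> and vanishes at \<open>psat M\<close>, so it is positive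
  below.\<close>

lemma interface_defect_self_pos:
  assumes "0 < p" "p < psat M"
  shows "interface_defect p p > 0"
proof -
  have "((\<lambda>x. g\<^sub>L x - g\<^sub>V x) has_real_derivative v\<^sub>L x - v\<^sub>V x) (at x within dom_of M Vapor)"
    if "p \<le> x" for x
  proof -
    have "(g\<^sub>L has_real_derivative v\<^sub>L x) (at x within dom_of M Vapor)"
      using assms that pmin_nonpos
      by (intro has_field_derivative_subset[OF gibbs_deriv]) auto
    then show ?thesis
      using gibbs_deriv[of x Vapor] assms that by (auto intro: DERIV_diff)
  qed
  from mvt_dom_of[OF pos_in_dom_of[OF assms(1)] assms(2) this] obtain x where x: "p < x" "x < psat M"
    and eq: "(g\<^sub>L (psat M) - g\<^sub>V (psat M)) - (g\<^sub>L p - g\<^sub>V p) = (v\<^sub>L x - v\<^sub>V x) * (psat M - p)"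
    by blast
  have "(v\<^sub>L x - v\<^sub>V x) * (psat M - p) < 0"
    using vol_liquid_less_vapor[of x x] x assms pmin_nonpos by (intro mult_neg_pos) auto
  then show ?thesis
    using eq gibbs_psat assms tau_pos by (simp add: interface_defect_self)
qed

lemma interface_defect_psat: "interface_defect (psat M) (psat M) = 0"
  by (simp add: interface_defect_self gibbs_psat)

section \<open>Existence, uniqueness and continuity of the liquid pressure\<close>

lemma continuous_on_vol_compose:
  "continuous_on S f \<Longrightarrow> f ` S \<subseteq> dom_of M K \<Longrightarrow> continuous_on S (\<lambda>x. vol M K (f x))"
  and continuous_on_gibbs_compose:
  "continuous_on S f \<Longrightarrow> f ` S \<subseteq> dom_of M K \<Longrightarrow> continuous_on S (\<lambda>x. gibbs M K (f x))"
  by (rule continuous_on_compose2[OF continuous_on_vol] continuous_on_compose2[OF continuous_on_gibbs];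
      assumption)+

lemma continuous_on_h_fun:
  assumes "continuous_on S f" "continuous_on S g" "f ` S \<subseteq> {0<..}" "g ` S \<subseteq> {pmin M..}"
  shows "continuous_on S (\<lambda>x. h_fun M (f x) (g x))"
  unfolding h_fun_def
  by (intro continuous_intros continuous_on_vol_compose continuous_on_gibbs_compose assms)
     (use assms in auto)

lemma continuous_on_interface_defect:
  assumes "continuous_on S f" "continuous_on S g" "f ` S \<subseteq> {0<..psat M}" "\<And>x. x \<in> S \<Longrightarrow> f x \<le> g x"
  shows "continuous_on S (\<lambda>x. interface_defect (f x) (g x))"
proof -
  have fg: "0 < f x" "f x \<le> psat M" "pmin M \<le> g x" if "x \<in> S" for x
    using that assms(3) assms(4)[OF that] pmin_nonpos by force+
  have "v\<^sub>V (f x) - v\<^sub>L (g x) \<noteq> 0" if "x \<in> S" for x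
    using vol_liquid_less_vapor[OF fg[OF that]] by simp
  then show ?thesis
    unfolding interface_defect_def
    by (intro continuous_intros continuous_on_vol_compose continuous_on_h_fun assms(1,2))
       (use fg in auto)
qed

lemma interface_defect_root_ex1:
  assumes p: "0 < p" "p \<le> psat M"
  shows "\<exists>!q. p \<le> q \<and> interface_defect p q = 0"
proof -
  have self: "interface_defect p p \<ge> 0"
    using interface_defect_self_pos[of p] interface_defect_psat p
    by (cases "p = psat M") auto
  define H where "H = p * h_fun M p p"
  have "H = interface_defect p p" by (simp add: H_def interface_defect_def)
  then have "H \<ge> 0" using self by simp
  have V: "v\<^sub>V p > 0" using p vol_pos[of p Vapor] by simp
  \<comment> \<open>Chosen so that \<open>sqrt ((b - p) / v\<^sub>V p) = H + 1\<close>. The root in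
    the defect is at least as large, while \<open>p * h_fun M p b\<close> is at most
    \<open>H\<close>.\<close>
  define b where "b = p + v\<^sub>V p * (H + 1)\<^sup>2"
  have "b > p" using V \<open>H \<ge> 0\<close> by (simp add: b_def)
  have L: "0 < v\<^sub>L b" "v\<^sub>L b < v\<^sub>V p"
    using vol_liquid_less_vapor[of p b] vol_pos[of b Liquid] p \<open>b > p\<close> pmin_nonpos by auto
  have "H + 1 = sqrt ((b - p) / v\<^sub>V p)" using V \<open>H \<ge> 0\<close> by (simp add: b_def)
  also have "\<dots> \<le> sqrt ((b - p) / (v\<^sub>V p - v\<^sub>L b))"
    using L \<open>b > p\<close> by (intro real_sqrt_le_mono divide_left_mono) auto
  finally have "H + 1 \<le> sqrt ((b - p) / (v\<^sub>V p - v\<^sub>L b))" .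
  moreover have "p * h_fun M p b \<le> H"
    unfolding H_def using h_fun_strict_antimono[of p p b] p \<open>b > p\<close> by simp
  ultimately have "interface_defect p b \<le> 0" by (simp add: interface_defect_def)
  moreover have "continuous_on {p..b} (interface_defect p)"
    by (rule continuous_on_interface_defect[where f = "\<lambda>_. p" and g = "\<lambda>x. x"]) (use p in auto)
  ultimately obtain q where "p \<le> q" "interface_defect p q = 0"
    using IVT2'[of "interface_defect p" b 0 p] self \<open>b > p\<close> by auto
  then show ?thesis
    using interface_defect_strict_antimono[OF p] by (metis less_irrefl linorder_less_linear)
qed

text \<open>Defined through the defect rather than as \<open>phi\<close>, whose uniqueness concerns
  all \<open>q\<close> within the sonic bounds. The two are identified in the final theorem under
  that uniqueness.\<close>

definition liquid_pressure :: "real \<Rightarrow> real" where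
  "liquid_pressure p = (THE q. p \<le> q \<and> interface_defect p q = 0)"

lemma liquid_pressure:
  assumes "0 < p" "p \<le> psat M"
  shows "p \<le> liquid_pressure p" "interface_defect p (liquid_pressure p) = 0"
  using theI'[OF interface_defect_root_ex1[OF assms]] by (auto simp: liquid_pressure_def)

text \<open>Through these equivalences, continuity of the root reduces to persistence of strict
  inequalities for the defect.\<close>

lemma interface_defect_pos_iff:
  assumes "0 < p" "p \<le> psat M" "p \<le> q"
  shows "interface_defect p q > 0 \<longleftrightarrow> q < liquid_pressure p"
    and "interface_defect p q < 0 \<longleftrightarrow> liquid_pressure p < q"
  using interface_defect_strict_antimono[OF assms(1,2), of q "liquid_pressure p"]
    interface_defect_strict_antimono[OF assms(1,2), of "liquid_pressure p" q]
    liquid_pressure[OF assms(1,2)] assms(3)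
  by (cases q "liquid_pressure p" rule: linorder_cases; simp)+

lemma liquid_pressure_gt: "0 < p \<Longrightarrow> p < psat M \<Longrightarrow> p < liquid_pressure p"
  using interface_defect_pos_iff(1)[of p p] interface_defect_self_pos by simp

lemma liquid_pressure_psat: "liquid_pressure (psat M) = psat M"
  using interface_defect_pos_iff[of "psat M" "psat M"] interface_defect_psat psat_pos by auto

lemma continuous_on_liquid_pressure: "continuous_on {0<..psat M} liquid_pressure"
  unfolding continuous_on_def
proof
  fix p assume p: "p \<in> {0<..psat M}"
  let ?F = "at p within {0<..psat M}"
  have in_dom: "\<forall>\<^sub>F x in ?F. x \<in> {0<..psat M}"
    by (simp add: eventually_at_topological) blast
  have id: "((\<lambda>x. x) \<longlongrightarrow> p) ?F" by (rule tendsto_ident_at)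
  \<comment> \<open>The maximum keeps the test pressure at or above \<open>x\<close>, where the
    defect is continuous and monotone.\<close>
  have lim: "((\<lambda>x. interface_defect x (max x a)) \<longlongrightarrow> interface_defect p (max p a)) ?F" for a
  proof -
    have "continuous_on {0<..psat M} (\<lambda>x. interface_defect x (max x a))"
      by (intro continuous_on_interface_defect continuous_intros) auto
    then show ?thesis using p by (simp add: continuous_on_def)
  qed
  show "(liquid_pressure \<longlongrightarrow> liquid_pressure p) ?F"
  proof (rule order_tendstoI)
    fix a assume a: "a < liquid_pressure p"
    show "\<forall>\<^sub>F x in ?F. a < liquid_pressure x"
    \<comment> \<open>If the root sits at \<open>p\<close> itself, no test pressure fits between
      \<open>p\<close> and the root; then \<open>x \<le> liquid_pressure x\<close> gives the lower
      bound.\<close>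
    proof (cases "p = liquid_pressure p")
      case True
      then have "\<forall>\<^sub>F x in ?F. a < x" using order_tendstoD(1)[OF id] a by simp
      then show ?thesis
        using in_dom
      proof eventually_elim
        case (elim x)
        then show ?case using liquid_pressure(1)[of x] by simp
      qed
    next
      case False
      then have "interface_defect p (max p a) > 0"
        using a p liquid_pressure(1)[of p] interface_defect_pos_iff(1)[of p "max p a"] by auto
      then have "\<forall>\<^sub>F x in ?F. interface_defect x (max x a) > 0"
        using order_tendstoD(1)[OF lim] by simp
      then show ?thesis
        using in_dom
      proof eventually_elim
        case (elim x)
        then show ?case using interface_defect_pos_iff(1)[of x "max x a"] by simp
      qed
    qed
  next
    fix b assume b: "liquid_pressure p < b"
    then have "p < b" using p liquid_pressure(1)[of p] by simp
    then have "interface_defect p (max p b) < 0"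
      using b p interface_defect_pos_iff(2)[of p "max p b"] by auto
    then have "\<forall>\<^sub>F x in ?F. interface_defect x (max x b) < 0"
      using order_tendstoD(2)[OF lim] by simp
    moreover have "\<forall>\<^sub>F x in ?F. x < b" using order_tendstoD(2)[OF id \<open>p < b\<close>] .
    ultimately show "\<forall>\<^sub>F x in ?F. liquid_pressure x < b"
      using in_dom
    proof eventually_elim
      case (elim x)
      then show ?case using interface_defect_pos_iff(2)[of x "max x b"] by simp
    qed
  qed
qed

section \<open>The mass flux on the evaporation branch\<close>

definition evaporation_flux :: "real \<Rightarrow> real" where
  "evaporation_flux p = p * h_fun M p (liquid_pressure p)"

text \<open>The second form is the momentum balance; the third is the velocity jump across the phase
  boundary.\<close>

lemma evaporation_flux_eq:
  assumes "0 < p" "p \<le> psat M"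
  defines "q \<equiv> liquid_pressure p"
  shows "evaporation_flux p = sqrt ((q - p) / (v\<^sub>V p - v\<^sub>L q))"
    and "(evaporation_flux p)\<^sup>2 * (v\<^sub>V p - v\<^sub>L q) = q - p"
    and "evaporation_flux p * (v\<^sub>V p - v\<^sub>L q) = sqrt ((q - p) * (v\<^sub>V p - v\<^sub>L q))"
proof -
  have q: "p \<le> q" "interface_defect p q = 0" using liquid_pressure[OF assms(1,2)] by (auto simp: q_def)
  have less: "v\<^sub>L q < v\<^sub>V p" using vol_liquid_less_vapor assms(1,2) q pmin_nonpos by simp
  show *: "evaporation_flux p = sqrt ((q - p) / (v\<^sub>V p - v\<^sub>L q))"
    using q(2) by (simp add: evaporation_flux_def interface_defect_def q_def)
  show sq: "(evaporation_flux p)\<^sup>2 * (v\<^sub>V p - v\<^sub>L q) = q - p"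
    unfolding * using q less by simp
  have "evaporation_flux p * (v\<^sub>V p - v\<^sub>L q) \<ge> 0" unfolding * using q less by simp
  moreover have "(evaporation_flux p * (v\<^sub>V p - v\<^sub>L q))\<^sup>2 = (q - p) * (v\<^sub>V p - v\<^sub>L q)"
    unfolding sq[symmetric] by (simp add: power2_eq_square)
  ultimately show "evaporation_flux p * (v\<^sub>V p - v\<^sub>L q) = sqrt ((q - p) * (v\<^sub>V p - v\<^sub>L q))"
    by (rule real_sqrt_unique[symmetric, rotated])
qed

lemma evaporation_flux_pos:
  assumes "0 < p" "p < psat M"
  shows "evaporation_flux p > 0"
proof -
  have q: "p < liquid_pressure p" by (rule liquid_pressure_gt[OF assms])
  then have "v\<^sub>L (liquid_pressure p) < v\<^sub>V p"
    using assms pmin_nonpos by (intro vol_liquid_less_vapor) auto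
  with q show ?thesis
    unfolding evaporation_flux_eq(1)[OF assms(1) less_imp_le[OF assms(2)]] by simp
qed

text \<open>Any liquid volume lies below the vapor volume at \<open>p\<close>, so the chord from the vapor state is
  steeper than every chord of the liquid branch ending at the same liquid state.\<close>

lemma evaporation_flux_less_chord:
  assumes "0 < p" "p < psat M" "pmin M \<le> r" "r < liquid_pressure p"
  shows "(evaporation_flux p)\<^sup>2 * (v\<^sub>L r - v\<^sub>L (liquid_pressure p)) < liquid_pressure p - r"
proof -
  define q where "q = liquid_pressure p"
  have pq: "p < q" unfolding q_def by (rule liquid_pressure_gt[OF assms(1,2)])
  have less: "v\<^sub>L r < v\<^sub>V p" "v\<^sub>L p < v\<^sub>V p" "v\<^sub>L q < v\<^sub>V p"
    using assms(1-3) pq pmin_nonpos by (auto intro!: vol_liquid_less_vapor)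
  have z: "(evaporation_flux p)\<^sup>2 * (v\<^sub>V p - v\<^sub>L q) = q - p"
    using evaporation_flux_eq(2)[of p] assms(1,2) by (simp add: q_def)
  have z0: "(evaporation_flux p)\<^sup>2 > 0" using evaporation_flux_pos[OF assms(1,2)] by simp
  have "(evaporation_flux p)\<^sup>2 * (v\<^sub>L r - v\<^sub>L q) < q - r"
  proof (cases "r \<le> p")
    case True
    have "(evaporation_flux p)\<^sup>2 * (v\<^sub>L r - v\<^sub>L q) < (evaporation_flux p)\<^sup>2 * (v\<^sub>V p - v\<^sub>L q)"
      using less z0 by (intro mult_strict_left_mono) auto
    then show ?thesis using z True by simp
  next
    case False
    have "(r - p) * (v\<^sub>L r - v\<^sub>L q) \<le> (q - r) * (v\<^sub>L p - v\<^sub>L r)"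
      using vol_three_points[OF pos_in_dom_of[OF assms(1)], of r q] assms(4) False
      by (simp add: q_def)
    also have "\<dots> < (q - r) * (v\<^sub>V p - v\<^sub>L r)"
      using less assms by (intro mult_strict_left_mono) (auto simp: q_def)
    finally have "(q - p) * (v\<^sub>L r - v\<^sub>L q) < (q - r) * (v\<^sub>V p - v\<^sub>L q)"
      by (simp add: algebra_simps)
    then have "((evaporation_flux p)\<^sup>2 * (v\<^sub>L r - v\<^sub>L q)) * (v\<^sub>V p - v\<^sub>L q) < (q - r) * (v\<^sub>V p - v\<^sub>L q)"
      unfolding z[symmetric] by (simp add: algebra_simps)
    then show ?thesis using less by (simp add: mult_less_cancel_right)
  qed
  then show ?thesis by (simp add: q_def)
qed

text \<open>By convexity the liquid curve is flatter at \<open>q\<close> than along its chord from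
  \<open>p\<close>, and that chord is flatter than the one from the vapor state, whose slope is
  \<open>- 1 / z\<^sup>2\<close> for the flux \<open>z\<close>.\<close>

lemma evaporation_flux_subsonic:
  assumes "0 < p" "p < psat M"
  defines "q \<equiv> liquid_pressure p"
  shows "evaporation_flux p * v\<^sub>L q < sound M Liquid q"
proof -
  have pq: "p < q" unfolding q_def by (rule liquid_pressure_gt[OF assms(1,2)])
  have dom: "q \<in> dom_of M Liquid" "p \<in> dom_of M Liquid"
    using pq assms(1) by (auto intro!: pos_in_dom_of simp del: dom_of.simps)
  have va: "v\<^sub>L q > 0" "sound M Liquid q > 0" by (rule vol_pos sound_pos dom)+
  have z: "(evaporation_flux p)\<^sup>2 > 0" using evaporation_flux_pos[OF assms(1,2)] by simp
  have "(evaporation_flux p)\<^sup>2 * (- dvol Liquid q * (q - p)) < (evaporation_flux p)\<^sup>2 * (v\<^sub>L p - v\<^sub>L q)"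
    using vol_chord_less_tangent(1)[OF dom(2) pq] z by (intro mult_strict_left_mono) auto
  also have "\<dots> < q - p"
    using evaporation_flux_less_chord[of p p] assms(1,2) pq pmin_nonpos by (simp add: q_def)
  finally have "((evaporation_flux p)\<^sup>2 * - dvol Liquid q) * (q - p) < 1 * (q - p)" by simp
  then have "(evaporation_flux p)\<^sup>2 * - dvol Liquid q < 1"
    using pq by (subst (asm) mult_less_cancel_right) simp
  then have "(evaporation_flux p)\<^sup>2 * (v\<^sub>L q)\<^sup>2 < (sound M Liquid q)\<^sup>2"
    using va by (simp add: dvol_def)
  then show ?thesis
    using va by (metis less_imp_le power_less_imp_less_base power_mult_distrib)
qed

lemma interface_pressure_liquid_pressure:
  assumes "0 < p" "p < psat M"
  shows "interface_pressure M p (liquid_pressure p)"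
  unfolding interface_pressure_def evaporation_flux_def[symmetric]
proof (intro conjI)
  let ?q = "liquid_pressure p"
  have pq: "p < ?q" by (rule liquid_pressure_gt[OF assms])
  have dom: "p \<in> dom_of M Vapor" "?q \<in> dom_of M Liquid"
    using pq assms(1) by (auto intro!: pos_in_dom_of simp del: dom_of.simps)
  show "pmin M \<le> ?q" using dom by simp
  show "?q - p + (evaporation_flux p)\<^sup>2 * (v\<^sub>L ?q - v\<^sub>V p) = 0"
    using evaporation_flux_eq(2)[of p] assms by (simp add: algebra_simps)
  show "evaporation_flux p \<le> sound M Liquid ?q / v\<^sub>L ?q"
    using evaporation_flux_subsonic[OF assms] vol_pos[OF dom(2)] by (simp add: field_simps)
  have "sound M Vapor p / v\<^sub>V p > 0" using vol_pos[OF dom(1)] sound_pos[OF dom(1)] by simp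
  then show "- (sound M Vapor p / v\<^sub>V p) \<le> evaporation_flux p"
    using evaporation_flux_pos[OF assms] by simp
qed

end

section \<open>Classical waves in the liquid\<close>

fun mirror :: "state \<Rightarrow> state" where "mirror (K, p, u) = (K, p, - u)"

lemma mirror_simps [simp]:
  "phase_of (mirror A) = phase_of A" "pres (mirror A) = pres A" "vel (mirror A) = - vel A"
  "density M (mirror A) = density M A" "mirror (mirror A) = A" "is_state M K (mirror A) = is_state M K A"
  by (cases A; simp add: is_state_def)+

lemma mass_flux_mirror: "mass_flux M (- W) (mirror A) = - mass_flux M W A"
  by (simp add: mass_flux_def algebra_simps)

lemma front_energy_mirror: "front_energy M (- W) (mirror A) = front_energy M W A"
  by (simp add: front_energy_def power2_commute)

text \<open>Reflection reverses the flux and exchanges the two sides, so the signs cancel in the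
  entropy inequality.\<close>

lemma jump_conditions_mirror:
  assumes "jump_conditions M W A B"
  shows "jump_conditions M (- W) (mirror B) (mirror A)"
proof -
  have "mass_flux M W B = mass_flux M W A" using assms by (simp add: jump_conditions_def)
  then show ?thesis
    using assms unfolding jump_conditions_def mass_flux_mirror front_energy_mirror
    by (simp add: algebra_simps)
qed

text \<open>The transition rate is invariant while the flux changes sign, which is the sign
  difference between the two kinetic relations.\<close>

lemma liquid_vapor_boundary_mirror:
  assumes "vapor_liquid_boundary M W V L"
  shows "liquid_vapor_boundary M (- W) (mirror L) (mirror V)"
proof -
  have "transition_rate M (- W) (mirror V) (mirror L) = transition_rate M W V L"
    by (simp add: transition_rate_def front_energy_mirror)
  moreover have "mass_flux M W L = mass_flux M W V"
    using assms by (simp add: vapor_liquid_boundary_def jump_conditions_def)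
  ultimately show ?thesis
    using assms jump_conditions_mirror[of M W V L]
    by (simp add: vapor_liquid_boundary_def liquid_vapor_boundary_def rate_admissible_def
        mass_flux_mirror)
qed

lemma euler_at_mirror:
  assumes "euler_at M U t (- x)"
  shows "euler_at M (\<lambda>\<xi>. mirror (U (- \<xi>))) t x"
proof -
  obtain r m n i where
    r: "((\<lambda>s. density M (U (- x / s))) has_real_derivative r) (at t)" and
    m: "((\<lambda>y. density M (U (y / t)) * vel (U (y / t))) has_real_derivative m) (at (- x))" and
    n: "((\<lambda>s. density M (U (- x / s)) * vel (U (- x / s))) has_real_derivative n) (at t)" and
    i: "((\<lambda>y. density M (U (y / t)) * (vel (U (y / t)))\<^sup>2 + pres (U (y / t))) has_real_derivative i)
      (at (- x))" and
    eq: "r + m = 0" "n + i = 0"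
    using assms unfolding euler_at_def Let_def by blast
  show ?thesis
    unfolding euler_at_def Let_def
    using r m[unfolded DERIV_mirror] DERIV_minus[OF n] i[unfolded DERIV_mirror] eq
      DERIV_minus[OF m[unfolded DERIV_mirror]]
    \<comment> \<open>Density and momentum flux are even and momentum is odd under reflection, while
      each space derivative adds a sign. So both terms of the momentum balance change sign and those
      of the mass balance do not.\<close>
    by (intro exI[of _ r] exI[of _ m] exI[of _ "- n"] exI[of _ "- i"]) simp
qed

text \<open>The hypothesis is on the reflected profile because waves are constructed facing right
  and then used on the left side of \<open>U\<close>.\<close>

lemma classical_wave_mirror:
  assumes "classical_wave M (\<lambda>\<xi>. mirror (U (- \<xi>))) s1 s2 A B"
  shows "classical_wave M U (- s2) (- s1) (mirror B) (mirror A)"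
proof -
  have "liquid_rarefaction M U (- s2) (- s1) (mirror B) (mirror A)"
    if "liquid_rarefaction M (\<lambda>\<xi>. mirror (U (- \<xi>))) s1 s2 A B"
  proof -
    note * = that[unfolded liquid_rarefaction_def]
    have cont: "continuous_on {- s2..- s1} (\<lambda>\<xi>. f (- \<xi>))" if "continuous_on {s1..s2} f"
      for f :: "real \<Rightarrow> real"
      by (rule continuous_on_compose2[OF that]) (auto intro: continuous_intros)
    have "euler_at M U t x" if "t > 0" "- s2 < x / t" "x / t < - s1" for t x
    proof -
      have "euler_at M (\<lambda>\<xi>. mirror (U (- \<xi>))) t (- x)"
        using * that by (simp add: minus_less_iff less_minus_iff)
      from euler_at_mirror[OF this] show ?thesis by simp
    qed
    moreover have "U (- s1) = mirror A" "U (- s2) = mirror B"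
      using * by (metis mirror_simps(5))+
    moreover have "is_state M Liquid (U \<xi>)" if "\<xi> \<in> {- s2..- s1}" for \<xi>
    proof -
      have "- \<xi> \<in> {s1..s2}" using that by auto
      then have "is_state M Liquid (mirror (U (- (- \<xi>))))" using * by blast
      then show ?thesis by simp
    qed
    moreover have "continuous_on {- s2..- s1} (\<lambda>\<xi>. pres (U \<xi>))"
      using cont[of "\<lambda>\<xi>. pres (mirror (U (- \<xi>)))"] * by simp
    moreover have "continuous_on {- s2..- s1} (\<lambda>\<xi>. vel (U \<xi>))"
      using continuous_on_minus[OF cont[of "\<lambda>\<xi>. vel (mirror (U (- \<xi>)))"]] * by simp
    ultimately show ?thesis
      using * unfolding liquid_rarefaction_def by auto
  qed
  then show ?thesis
    using assms jump_conditions_mirror[of M s1 A B] unfolding classical_wave_def by auto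
qed

text \<open>For functions of \<open>x / t\<close>, the time derivative is \<open>- \<xi> / t\<close>
  and the space derivative \<open>1 / t\<close> times the derivative in \<xi>. The last two
  hypotheses are the resulting ordinary differential equations in nonconservative form.\<close>

lemma euler_atI:
  assumes "t > 0" and \<xi>: "\<xi> = x / t"
    and r: "((\<lambda>\<xi>. density M (U \<xi>)) has_real_derivative r) (at \<xi>)"
    and u: "((\<lambda>\<xi>. vel (U \<xi>)) has_real_derivative u) (at \<xi>)"
    and p: "((\<lambda>\<xi>. pres (U \<xi>)) has_real_derivative p) (at \<xi>)"
    and mass: "r * (vel (U \<xi>) - \<xi>) + density M (U \<xi>) * u = 0"
    and momentum: "density M (U \<xi>) * (vel (U \<xi>) - \<xi>) * u + p = 0"
  shows "euler_at M U t x"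
proof -
  define R V where "R = density M (U \<xi>)" and "V = vel (U \<xi>)"
  have x: "x = \<xi> * t" using assms by simp
  have t: "((\<lambda>s. f (x / s)) has_real_derivative - (\<xi> / t) * D) (at t)"
    if "(f has_real_derivative D) (at \<xi>)" for f D
  proof -
    have d: "((\<lambda>s. x / s) has_real_derivative - (\<xi> / t)) (at t)"
      using \<open>t > 0\<close> by (auto intro!: derivative_eq_intros simp: \<xi> power2_eq_square)
    from DERIV_chain2[OF _ d, of f D] that show ?thesis by (simp add: \<xi> mult.commute)
  qed
  have y: "((\<lambda>y. f (y / t)) has_real_derivative D / t) (at x)"
    if "(f has_real_derivative D) (at \<xi>)" for f D
  proof -
    have d: "((\<lambda>y. y / t) has_real_derivative 1 / t) (at x)"
      using \<open>t > 0\<close> by (auto intro!: derivative_eq_intros)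
    from DERIV_chain2[OF _ d, of f D] that show ?thesis by (simp add: \<xi>)
  qed
  have m: "((\<lambda>\<xi>. density M (U \<xi>) * vel (U \<xi>)) has_real_derivative r * V + u * R) (at \<xi>)"
    using DERIV_mult[OF r u] by (simp add: R_def V_def algebra_simps)
  have i: "((\<lambda>\<xi>. density M (U \<xi>) * (vel (U \<xi>))\<^sup>2 + pres (U \<xi>)) has_real_derivative
      r * V\<^sup>2 + 2 * R * V * u + p) (at \<xi>)"
    using r u p by (auto intro!: derivative_eq_intros simp: R_def V_def)
  have mass': "r * (V - \<xi>) + R * u = 0" and momentum': "R * (V - \<xi>) * u + p = 0"
    using mass momentum by (auto simp: R_def V_def)
  have "- (\<xi> / t) * r + (r * V + u * R) / t = (r * (V - \<xi>) + R * u) / t"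
    using \<open>t > 0\<close> by (simp add: field_simps)
  then have 1: "- (\<xi> / t) * r + (r * V + u * R) / t = 0" unfolding mass' by simp
  \<comment> \<open>The conservative momentum balance is the nonconservative one plus the velocity
    times the mass balance.\<close>
  have "- (\<xi> / t) * (r * V + u * R) + (r * V\<^sup>2 + 2 * R * V * u + p) / t =
      (V * (r * (V - \<xi>) + R * u) + (R * (V - \<xi>) * u + p)) / t"
    using \<open>t > 0\<close> by (simp add: field_simps power2_eq_square)
  then have 2: "- (\<xi> / t) * (r * V + u * R) + (r * V\<^sup>2 + 2 * R * V * u + p) / t = 0"
    unfolding mass' momentum' by simp
  show ?thesis
    unfolding euler_at_def Let_def
    by (intro exI conjI) (rule t[OF r] y[OF m] t[OF m] y[OF i] 1 2)+
qed

section \<open>Wave functions and classical waves of the liquid\<close>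

context fluid
begin

abbreviation "a\<^sub>L \<equiv> sound M Liquid"

text \<open>The base point \<open>pmin M\<close> only fixes a constant. It turns the rarefaction
  branch of \<open>wave_fun\<close> into a difference of values of one function.\<close>

definition riemann_invariant :: "real \<Rightarrow> real" where
  "riemann_invariant x = integral {pmin M..x} (\<lambda>\<zeta>. v\<^sub>L \<zeta> / a\<^sub>L \<zeta>)"

lemma continuous_on_vol_div_sound: "continuous_on {pmin M..} (\<lambda>\<zeta>. v\<^sub>L \<zeta> / a\<^sub>L \<zeta>)"
proof -
  have "a\<^sub>L x \<noteq> 0" if "x \<in> {pmin M..}" for x using sound_pos[of x Liquid] that by simp
  then show ?thesis
    using continuous_on_vol[of Liquid] continuous_on_sound[of Liquid]
    by (intro continuous_on_divide) auto
qed

lemma liquid_deriv_at: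
  assumes "pmin M < x"
  shows "at x within dom_of M Liquid = at x"
  using assms by (intro at_within_interior) (simp add: interior_Ici)

lemma riemann_invariant_deriv:
  assumes "pmin M < x"
  shows "(riemann_invariant has_real_derivative v\<^sub>L x / a\<^sub>L x) (at x)"
proof -
  have "continuous_on {pmin M..x + 1} (\<lambda>\<zeta>. v\<^sub>L \<zeta> / a\<^sub>L \<zeta>)"
    by (rule continuous_on_subset[OF continuous_on_vol_div_sound]) auto
  from integral_has_real_derivative[OF this, of x]
  have "(riemann_invariant has_real_derivative v\<^sub>L x / a\<^sub>L x) (at x within {pmin M..x + 1})"
    using assms by (simp add: riemann_invariant_def[abs_def])
  moreover have "at x within {pmin M..x + 1} = at x"
    using assms by (intro at_within_interior) simp
  ultimately show ?thesis by simp
qed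

lemma wave_fun_shock:
  "p < q \<Longrightarrow> wave_fun M p q = sqrt ((q - p) * (v\<^sub>L p - v\<^sub>L q))"
  by (simp add: wave_fun_def algebra_simps)

lemma wave_fun_rarefaction:
  assumes "pmin M \<le> q" "q \<le> p"
  shows "wave_fun M p q = riemann_invariant q - riemann_invariant p"
proof -
  have "(\<lambda>\<zeta>. v\<^sub>L \<zeta> / a\<^sub>L \<zeta>) integrable_on {pmin M..p}"
    by (rule integrable_continuous_interval)
       (rule continuous_on_subset[OF continuous_on_vol_div_sound], auto)
  from Henstock_Kurzweil_Integration.integral_combine[OF assms this]
  show ?thesis using assms by (simp add: wave_fun_def riemann_invariant_def)
qed

lemma wave_fun_rarefaction_nonpos:
  assumes "pmin M \<le> q" "q \<le> p"
  shows "wave_fun M p q \<le> 0"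
proof -
  have "(\<lambda>\<zeta>. v\<^sub>L \<zeta> / a\<^sub>L \<zeta>) integrable_on {q..p}"
    by (rule integrable_continuous_interval)
       (rule continuous_on_subset[OF continuous_on_vol_div_sound], use assms in auto)
  then have "integral {q..p} (\<lambda>\<zeta>. v\<^sub>L \<zeta> / a\<^sub>L \<zeta>) \<ge> 0"
    using assms vol_pos[of _ Liquid] sound_pos[of _ Liquid]
    by (intro integral_nonneg) (auto simp: less_imp_le)
  then show ?thesis using assms by (simp add: wave_fun_def)
qed

text \<open>\<open>v\<^sub>L (pmin M)\<close> is the largest liquid volume, and rarefactions
  contribute nonpositively. The bound is uniform in the initial pressure.\<close>

lemma wave_fun_le:
  assumes "pmin M \<le> q" "pmin M \<le> p"
  shows "wave_fun M p q \<le> sqrt ((q - pmin M) * v\<^sub>L (pmin M))"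
proof (cases "p < q")
  case True
  have "v\<^sub>L p \<le> v\<^sub>L (pmin M)" "v\<^sub>L q > 0"
    using vol_antimono[of "pmin M" Liquid p] vol_pos[of q Liquid] assms by auto
  moreover have "v\<^sub>L q \<le> v\<^sub>L p" using vol_antimono[of p Liquid q] assms True by simp
  ultimately show ?thesis
    unfolding wave_fun_shock[OF True] using assms True
    by (intro real_sqrt_le_mono mult_mono) auto
next
  case False
  then have "wave_fun M p q \<le> 0" using assms by (intro wave_fun_rarefaction_nonpos) auto
  also have "0 \<le> sqrt ((q - pmin M) * v\<^sub>L (pmin M))"
    using assms vol_pos[of "pmin M" Liquid] by simp
  finally show ?thesis .
qed

lemma continuous_on_wave_fun:
  assumes "pmin M \<le> p"
  shows "continuous_on {0<..} (wave_fun M p)"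
proof (cases "p > 0")
  \<comment> \<open>Here every \<open>q\<close> in the domain lies on the shock branch.\<close>
  case False
  have "continuous_on {0<..} v\<^sub>L"
    by (rule continuous_on_subset[OF continuous_on_vol[of Liquid]]) (use pmin_nonpos in auto)
  then have "continuous_on {0<..} (\<lambda>q. sqrt ((q - p) * (v\<^sub>L p - v\<^sub>L q)))"
    by (intro continuous_intros)
  then show ?thesis
    by (rule continuous_on_eq) (use False in \<open>auto simp: wave_fun_shock\<close>)
next
  case True
  have "continuous_on {pmin M<..} riemann_invariant"
    by (rule DERIV_continuous_on, rule DERIV_subset, rule riemann_invariant_deriv) auto
  then have "continuous_on {0<..} (\<lambda>q. riemann_invariant (min q p))"
    by (rule continuous_on_compose2)
       (use True pmin_nonpos in \<open>auto intro!: continuous_on_min continuous_on_id continuous_on_const\<close>)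
  moreover have "continuous_on {0<..} (\<lambda>q. v\<^sub>L (max q p))"
    by (rule continuous_on_compose2[OF continuous_on_vol[of Liquid]])
       (use True pmin_nonpos in \<open>auto intro!: continuous_on_max continuous_on_id continuous_on_const\<close>)
  \<comment> \<open>Clamping glues the branches: the shock term vanishes for
    \<open>q \<le> p\<close>, the rarefaction term for \<open>q \<ge> p\<close>.\<close>
  ultimately have "continuous_on {0<..} (\<lambda>q. sqrt ((max q p - p) * (v\<^sub>L p - v\<^sub>L (max q p)))
      + (riemann_invariant (min q p) - riemann_invariant p))"
    by (intro continuous_on_add continuous_on_diff continuous_on_mult continuous_on_real_sqrt
        continuous_on_max continuous_on_id continuous_on_const)
  then show ?thesis
  proof (rule continuous_on_eq)
    fix q :: real assume "q \<in> {0<..}"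
    then show "sqrt ((max q p - p) * (v\<^sub>L p - v\<^sub>L (max q p)))
        + (riemann_invariant (min q p) - riemann_invariant p) = wave_fun M p q"
      using pmin_nonpos by (cases "p < q") (auto simp: wave_fun_shock wave_fun_rarefaction)
  qed
qed

text \<open>From \<open>p + 1\<close> on the volume drop is at least \<open>d\<close>, so the shock
  branch grows at least like a square root.\<close>

lemma wave_fun_at_top:
  assumes "pmin M \<le> p"
  shows "filterlim (wave_fun M p) at_top at_top"
proof -
  define d where "d = v\<^sub>L p - v\<^sub>L (p + 1)"
  have "d > 0" using vol_strict_antimono[of p Liquid "p + 1"] assms by (simp add: d_def)
  have "filterlim (\<lambda>q. d * (- p + q)) at_top at_top"
    by (intro filterlim_tendsto_pos_mult_at_top[OF tendsto_const \<open>d > 0\<close>]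
        filterlim_tendsto_add_at_top[OF tendsto_const] filterlim_ident)
  then have "filterlim (\<lambda>q. sqrt (d * (- p + q))) at_top at_top"
    by (rule filterlim_compose[OF sqrt_at_top])
  moreover have "\<forall>\<^sub>F q in at_top. sqrt (d * (- p + q)) \<le> wave_fun M p q"
    using eventually_ge_at_top[of "p + 1"]
  proof eventually_elim
    case (elim q)
    then have "v\<^sub>L q \<le> v\<^sub>L (p + 1)" using assms by (intro vol_antimono) auto
    then have "d * (- p + q) \<le> (q - p) * (v\<^sub>L p - v\<^sub>L q)"
      using elim by (simp add: d_def mult.commute mult_left_mono)
    moreover have "p < q" using elim by simp
    ultimately show ?case by (simp add: wave_fun_shock)
  qed
  ultimately show ?thesis by (rule filterlim_at_top_mono)
qed

text \<open>A rarefaction fan facing right: along it the velocity minus the Riemann invariant is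
  constant, and the similarity variable is the characteristic speed \<open>u + a\<close>, which increases with
  the pressure because the fundamental derivative is positive. The profile is the inverse
  function.\<close>

lemma liquid_rarefaction_exists:
  assumes q: "pmin M < q" and "q < p"
  defines "F \<equiv> wave_fun M p q"
  shows "\<exists>prof s. u + F + a\<^sub>L q < s \<and>
    (\<forall>U. (\<forall>\<xi>\<in>{u + F + a\<^sub>L q..s}. U \<xi> = prof \<xi>) \<longrightarrow>
      liquid_rarefaction M U (u + F + a\<^sub>L q) s (Liquid, q, u + F) (Liquid, p, u))"
proof -
  define w where "w x = u + (riemann_invariant x - riemann_invariant p)" for x
  define \<mu> where "\<mu> x = w x + a\<^sub>L x" for x
  have w_q: "w q = u + F" and w_p: "w p = u"
    using assms by (auto simp: w_def wave_fun_rarefaction)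
  have va: "v\<^sub>L x > 0" "a\<^sub>L x > 0" if "pmin M < x" for x
    using that vol_pos[of x Liquid] sound_pos[of x Liquid] by auto
  have w_deriv: "(w has_real_derivative v\<^sub>L x / a\<^sub>L x) (at x)" if "pmin M < x" for x
    unfolding w_def by (auto intro!: derivative_eq_intros riemann_invariant_deriv that)
  have "\<exists>e. (\<mu> has_real_derivative e) (at x) \<and> e > 0" if x: "pmin M < x" for x
  proof -
    have "x \<in> dom_of M Liquid" using x by simp
    then obtain d where "(a\<^sub>L has_real_derivative d) (at x within dom_of M Liquid)"
      and G: "1 + a\<^sub>L x / v\<^sub>L x * d > 0"
      by (rule sound_deriv)
    then have d: "(a\<^sub>L has_real_derivative d) (at x)" unfolding liquid_deriv_at[OF x] by simp
    \<comment> \<open>This is the derivative of \<mu>: a positive multiple of the fundamental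
      derivative.\<close>
    have "v\<^sub>L x / a\<^sub>L x + d = v\<^sub>L x / a\<^sub>L x * (1 + a\<^sub>L x / v\<^sub>L x * d)"
      using va[OF x] by (simp add: field_simps)
    also have "\<dots> > 0" using va[OF x] G by simp
    finally show ?thesis
      using DERIV_add[OF w_deriv[OF x] d] by (auto simp: \<mu>_def[abs_def])
  qed
  then obtain e where e: "\<And>x. pmin M < x \<Longrightarrow> (\<mu> has_real_derivative e x) (at x)"
      "\<And>x. pmin M < x \<Longrightarrow> e x > 0"
    by metis
  have mono: "\<mu> x < \<mu> y" if "pmin M < x" "x < y" for x y
  proof (rule DERIV_pos_imp_increasing[OF that(2)])
    fix z assume "x \<le> z"
    then show "\<exists>e. (\<mu> has_real_derivative e) (at z) \<and> 0 < e"
      using e[of z] that(1) by (intro exI[of _ "e z"]) auto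
  qed
  have cont: "continuous_on {q..p} \<mu>"
    by (rule DERIV_continuous_on, rule DERIV_subset, rule e(1)) (use q in auto)
  have inj: "inj_on \<mu> {q..p}"
  proof (rule linorder_inj_onI')
    fix x y assume "x \<in> {q..p}" "x < y"
    then show "\<mu> x \<noteq> \<mu> y" using mono[of x y] q by auto
  qed
  have image: "\<mu> ` {q..p} = {\<mu> q..\<mu> p}"
  proof
    show "\<mu> ` {q..p} \<subseteq> {\<mu> q..\<mu> p}"
    proof (rule image_subsetI)
      fix x assume "x \<in> {q..p}"
      then show "\<mu> x \<in> {\<mu> q..\<mu> p}"
        using mono[of q x] mono[of x p] q by (cases "x = q"; cases "x = p") auto
    qed
    show "{\<mu> q..\<mu> p} \<subseteq> \<mu> ` {q..p}"
    proof
      fix y assume "y \<in> {\<mu> q..\<mu> p}"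
      then show "y \<in> \<mu> ` {q..p}"
        using IVT'[OF _ _ _ cont, of y] assms(2) by fastforce
    qed
  qed
  define P where "P = inv_into {q..p} \<mu>"
  have P_\<mu>: "P (\<mu> x) = x" if "x \<in> {q..p}" for x
    using inv_into_f_f[OF inj that] by (simp add: P_def)
  have P_cont: "continuous_on {\<mu> q..\<mu> p} P"
    using continuous_on_inv[OF cont compact_Icc, of P] P_\<mu> unfolding image by blast
  have P_mem: "P y \<in> {q..p}" and \<mu>_P: "\<mu> (P y) = y" if "y \<in> {\<mu> q..\<mu> p}" for y
    using that inv_into_into[of y \<mu> "{q..p}"] f_inv_into_f[of y \<mu> "{q..p}"]
    unfolding P_def image by auto
  have P_deriv: "(P has_real_derivative inverse (e (P y))) (at y)" if "y \<in> {\<mu> q<..<\<mu> p}" for y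
  proof (rule DERIV_inverse_function)
    have y: "y \<in> {\<mu> q..\<mu> p}" using that by auto
    show "(\<mu> has_real_derivative e (P y)) (at (P y))" "e (P y) \<noteq> 0"
      using e[of "P y"] P_mem[OF y] q by auto
    show "\<mu> q < y" "y < \<mu> p" using that by auto
    show "\<mu> (P z) = z" if "\<mu> q < z" "z < \<mu> p" for z using \<mu>_P that by simp
    show "isCont P y"
      using continuous_on_interior[OF P_cont] that by simp
  qed
  define prof where "prof \<xi> = (Liquid, P \<xi>, w (P \<xi>))" for \<xi>
  show ?thesis
  proof (intro exI[of _ prof] exI[of _ "\<mu> p"] conjI allI impI)
    have \<mu>_q: "u + F + a\<^sub>L q = \<mu> q" by (simp add: \<mu>_def w_q)
    show less: "u + F + a\<^sub>L q < \<mu> p" unfolding \<mu>_q using mono assms(1,2) by simp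
    fix U assume "\<forall>\<xi>\<in>{u + F + a\<^sub>L q..\<mu> p}. U \<xi> = prof \<xi>"
    then have U: "U \<xi> = prof \<xi>" if "\<xi> \<in> {\<mu> q..\<mu> p}" for \<xi> using that \<mu>_q by simp
    show "liquid_rarefaction M U (u + F + a\<^sub>L q) (\<mu> p) (Liquid, q, u + F) (Liquid, p, u)"
      unfolding liquid_rarefaction_def \<mu>_q
    proof (intro conjI ballI allI impI)
      show "\<mu> q < \<mu> p" using less \<mu>_q by simp
      show "U (\<mu> q) = (Liquid, q, u + F)" "U (\<mu> p) = (Liquid, p, u)"
        using U[of "\<mu> q"] U[of "\<mu> p"] less \<mu>_q P_\<mu>[of q] P_\<mu>[of p] assms(1,2) w_q w_p
        by (auto simp: prof_def)
      show "is_state M Liquid (U \<xi>)" if "\<xi> \<in> {\<mu> q..\<mu> p}" for \<xi>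
        using U[OF that] P_mem[OF that] q by (simp add: prof_def is_state_def)
      show "continuous_on {\<mu> q..\<mu> p} (\<lambda>\<xi>. pres (U \<xi>))"
        by (rule continuous_on_eq[OF P_cont]) (simp add: U prof_def)
      have "continuous_on {q..p} w"
        by (rule DERIV_continuous_on, rule DERIV_subset, rule w_deriv) (use q in auto)
      then have "continuous_on {\<mu> q..\<mu> p} (\<lambda>\<xi>. w (P \<xi>))"
        by (rule continuous_on_compose2[OF _ P_cont]) (use P_mem in blast)
      then show "continuous_on {\<mu> q..\<mu> p} (\<lambda>\<xi>. vel (U \<xi>))"
        by (rule continuous_on_eq) (simp add: U prof_def)
    next
      fix t x :: real assume tx: "t > 0 \<and> \<mu> q < x / t \<and> x / t < \<mu> p"
      define \<xi> where "\<xi> = x / t"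
      define y where "y = P \<xi>"
      have \<xi>: "\<xi> \<in> {\<mu> q<..<\<mu> p}" using tx by (simp add: \<xi>_def)
      then have y: "pmin M < y" "\<mu> y = \<xi>" using P_mem[of \<xi>] \<mu>_P[of \<xi>] q by (auto simp: y_def)
      have P': "(P has_real_derivative inverse (e y)) (at \<xi>)" using P_deriv[OF \<xi>] by (simp add: y_def)
      have U_\<xi>: "U \<xi> = (Liquid, y, w y)" using U[of \<xi>] \<xi> by (simp add: prof_def y_def)
      \<comment> \<open>\<open>U\<close> agrees with \<open>prof\<close> on the fan only, so
        derivatives are transferred within the open interval around \<xi>.\<close>
      have local: "((\<lambda>\<xi>. f (U \<xi>)) has_real_derivative D) (at \<xi>)"
        if "((\<lambda>\<xi>. f (prof \<xi>)) has_real_derivative D) (at \<xi>)" for f D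
        by (rule has_field_derivative_transform_within_open[OF that open_greaterThanLessThan \<xi>])
           (simp add: U)
      have p': "((\<lambda>\<xi>. pres (U \<xi>)) has_real_derivative inverse (e y)) (at \<xi>)"
        by (rule local) (simp add: prof_def P')
      have u': "((\<lambda>\<xi>. vel (U \<xi>)) has_real_derivative v\<^sub>L y / a\<^sub>L y * inverse (e y)) (at \<xi>)"
        by (rule local) (use DERIV_chain2[OF w_deriv P'] y in \<open>simp add: prof_def y_def\<close>)
      have "(v\<^sub>L has_real_derivative - ((v\<^sub>L y)\<^sup>2 / (a\<^sub>L y)\<^sup>2)) (at y)"
        using vol_deriv[of y Liquid] y liquid_deriv_at[OF y(1)] by (simp add: dvol_def)
      then have "((\<lambda>y. 1 / v\<^sub>L y) has_real_derivative 1 / (a\<^sub>L y)\<^sup>2) (at y)"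
        using va[OF y(1)] by (auto intro!: derivative_eq_intros simp: power2_eq_square)
      from DERIV_chain2[OF this[unfolded y_def] P']
      have r': "((\<lambda>\<xi>. density M (U \<xi>)) has_real_derivative 1 / (a\<^sub>L y)\<^sup>2 * inverse (e y)) (at \<xi>)"
        by (intro local) (simp add: prof_def y_def)
      \<comment> \<open>Relative to each ray the fluid moves with velocity
        \<open>- a\<^sub>L y\<close>, which makes both ordinary differential equations
        cancel.\<close>
      have speed: "w y - \<xi> = - a\<^sub>L y" using y(2) by (simp add: \<mu>_def)
      show "euler_at M U t x"
      proof (rule euler_atI[OF _ \<xi>_def r' u' p'])
        show "t > 0" using tx by simp
        show "1 / (a\<^sub>L y)\<^sup>2 * inverse (e y) * (vel (U \<xi>) - \<xi>)
            + density M (U \<xi>) * (v\<^sub>L y / a\<^sub>L y * inverse (e y)) = 0"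
          using va[OF y(1)] by (simp add: U_\<xi> speed power2_eq_square)
        show "density M (U \<xi>) * (vel (U \<xi>) - \<xi>) * (v\<^sub>L y / a\<^sub>L y * inverse (e y))
            + inverse (e y) = 0"
          using va[OF y(1)] by (simp add: U_\<xi> speed)
      qed
    qed
  qed
qed

text \<open>\<open>Q\<close> is the mass flux given by the slope of the chord, and the trapezoidal
  bound yields the entropy inequality. The second claim expresses the shock speed from the side of
  \<open>q\<close>, for comparison with a phase boundary.\<close>

lemma liquid_shock:
  assumes p: "pmin M \<le> p" and pq: "p < q"
  defines "Q \<equiv> sqrt ((q - p) / (v\<^sub>L p - v\<^sub>L q))"
  shows "jump_conditions M (u + Q * v\<^sub>L p) (Liquid, q, u + wave_fun M p q) (Liquid, p, u)"
    and "u + Q * v\<^sub>L p = u + wave_fun M p q + Q * v\<^sub>L q"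
proof -
  have dom: "p \<in> dom_of M Liquid" "q \<in> dom_of M Liquid" using assms by auto
  have v: "v\<^sub>L q < v\<^sub>L p" "v\<^sub>L q > 0" "v\<^sub>L p > 0"
    using vol_strict_antimono[OF dom(1) pq] vol_pos dom by auto
  have Q: "Q > 0" "Q\<^sup>2 * (v\<^sub>L p - v\<^sub>L q) = q - p"
    using v pq by (auto simp: Q_def)
  have F: "wave_fun M p q = Q * (v\<^sub>L p - v\<^sub>L q)"
    unfolding wave_fun_shock[OF pq] Q(2)[symmetric]
    using Q(1) v by (intro real_sqrt_unique) (auto simp: power2_eq_square)
  show "u + Q * v\<^sub>L p = u + wave_fun M p q + Q * v\<^sub>L q" by (simp add: F algebra_simps)
  have flux: "mass_flux M (u + Q * v\<^sub>L p) (Liquid, q, u + wave_fun M p q) = Q"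
    "mass_flux M (u + Q * v\<^sub>L p) (Liquid, p, u) = Q"
    using v by (auto simp: mass_flux_def F field_simps)
  have "g\<^sub>L q - g\<^sub>L p \<le> (q - p) * (v\<^sub>L p + v\<^sub>L q) / 2" by (rule gibbs_trapezoid[OF dom(1) pq])
  also have "\<dots> = ((Q * v\<^sub>L p)\<^sup>2 - (Q * v\<^sub>L q)\<^sup>2) / 2"
    unfolding Q(2)[symmetric] by (simp add: power2_eq_square algebra_simps)
  finally have "front_energy M (u + Q * v\<^sub>L p) (Liquid, p, u)
      - front_energy M (u + Q * v\<^sub>L p) (Liquid, q, u + wave_fun M p q) \<ge> 0"
    by (simp add: front_energy_def F algebra_simps diff_divide_distrib)
  moreover have "Q * wave_fun M p q = q - p"
    unfolding F Q(2)[symmetric] by (simp add: power2_eq_square)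
  ultimately show "jump_conditions M (u + Q * v\<^sub>L p) (Liquid, q, u + wave_fun M p q) (Liquid, p, u)"
    using Q(1) unfolding jump_conditions_def flux by simp
qed

text \<open>\<open>u + F + z * v\<^sub>L q\<close> is the speed of a front with flux
  \<open>z\<close> next to the state at \<open>q\<close>. The chord condition places a shock ahead
  of it, the subsonic condition a rarefaction. Quantifying over every \<open>U\<close> that agrees
  with \<open>prof\<close> lets the wave be pasted into a larger profile.\<close>

lemma liquid_wave_exists:
  assumes "pmin M < q" "pmin M \<le> p" "z \<ge> 0"
    and subsonic: "z * v\<^sub>L q < a\<^sub>L q"
    and chord: "p < q \<Longrightarrow> z\<^sup>2 * (v\<^sub>L p - v\<^sub>L q) < q - p"
  defines "F \<equiv> wave_fun M p q"
  shows "\<exists>prof s s'. u + F + z * v\<^sub>L q < s \<and> s \<le> s' \<and>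
    (\<forall>U. (\<forall>\<xi>\<in>{s..s'}. U \<xi> = prof \<xi>) \<longrightarrow>
      classical_wave M U s s' (Liquid, q, u + F) (Liquid, p, u))"
proof (cases p q rule: linorder_cases)
  case less
  define Q where "Q = sqrt ((q - p) / (v\<^sub>L p - v\<^sub>L q))"
  have v: "v\<^sub>L q < v\<^sub>L p" "v\<^sub>L q > 0"
    using vol_strict_antimono[of p Liquid q] vol_pos[of q Liquid] assms(1,2) less by auto
  have "z = sqrt (z\<^sup>2)" using \<open>z \<ge> 0\<close> by simp
  also have "\<dots> < Q"
    unfolding Q_def using chord[OF less] v by (intro real_sqrt_less_mono) (simp add: field_simps)
  finally have "z * v\<^sub>L q < Q * v\<^sub>L q" using v by simp
  then have "u + F + z * v\<^sub>L q < u + Q * v\<^sub>L p"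
    using liquid_shock(2)[OF assms(2) less, of u] by (simp add: Q_def F_def)
  moreover have "classical_wave M U (u + Q * v\<^sub>L p) (u + Q * v\<^sub>L p) (Liquid, q, u + F) (Liquid, p, u)" for U
    using liquid_shock(1)[OF assms(2) less, of u] assms(1,2)
    by (simp add: classical_wave_def is_state_def Q_def F_def)
  ultimately show ?thesis by blast
next
  case equal
  then have "F = 0" by (simp add: wave_fun_def F_def)
  then have "classical_wave M U s s (Liquid, q, u + F) (Liquid, p, u)" for U s
    using assms(2) equal by (simp add: classical_wave_def is_state_def jump_conditions_def)
  \<comment> \<open>A wave of strength zero can sit anywhere ahead of the front; the offset 1 is
    arbitrary.\<close>
  moreover have "u + F + z * v\<^sub>L q < u + F + z * v\<^sub>L q + 1" by simp
  ultimately show ?thesis by blast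
next
  case greater
  obtain prof s' where *: "u + F + a\<^sub>L q < s'"
    "\<And>U. \<forall>\<xi>\<in>{u + F + a\<^sub>L q..s'}. U \<xi> = prof \<xi> \<Longrightarrow>
      liquid_rarefaction M U (u + F + a\<^sub>L q) s' (Liquid, q, u + F) (Liquid, p, u)"
    using liquid_rarefaction_exists[OF assms(1) greater, of u] unfolding F_def by blast
  have "classical_wave M U (u + F + a\<^sub>L q) s' (Liquid, q, u + F) (Liquid, p, u)"
    if "\<forall>\<xi>\<in>{u + F + a\<^sub>L q..s'}. U \<xi> = prof \<xi>" for U
    using *(2)[OF that] assms(1,2) by (simp add: classical_wave_def is_state_def)
  moreover have "u + F + z * v\<^sub>L q < u + F + a\<^sub>L q" using subsonic by simp
  ultimately show ?thesis using less_imp_le[OF *(1)] by blast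
qed

end

section \<open>The Riemann problem\<close>

context structured_fluid
begin

text \<open>The condition \<open>\<gamma>\<^sub>V \<le> 1\<close> says that \<open>p v\<^sub>V(p)\<close> is nonincreasing, so the vapor volume blows up
  at least like \<open>1 / p\<close> and the vapor Gibbs energy tends to minus infinity at least
  logarithmically.\<close>

lemma pressure_times_vol_vapor_ge:
  assumes "0 < p" "p \<le> psat M"
  shows "psat M * v\<^sub>V (psat M) \<le> p * v\<^sub>V p"
proof (cases "p = psat M")
  case False
  then have less: "p < psat M" using assms by simp
  have dom: "p \<in> dom_of M Vapor" using assms by simp
  have "((\<lambda>x. x * v\<^sub>V x) has_real_derivative v\<^sub>V x + x * dvol Vapor x) (at x within dom_of M Vapor)"
    if "p \<le> x" for x
    using DERIV_mult[OF DERIV_ident vol_deriv[OF dom_of_upward[OF dom that]]]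
    by (simp add: mult.commute)
  from mvt_dom_of[OF dom less this] obtain x where x: "p < x" "x < psat M"
    and eq: "psat M * v\<^sub>V (psat M) - p * v\<^sub>V p = (v\<^sub>V x + x * dvol Vapor x) * (psat M - p)" by metis
  have va: "v\<^sub>V x > 0" "sound M Vapor x > 0"
    using x assms vol_pos[of x Vapor] sound_pos[of x Vapor] by auto
  have "(sound M Vapor x)\<^sup>2 \<le> x * v\<^sub>V x"
    using gam_vapor_le_1[of x] x assms va by (simp add: gam_def)
  then have "v\<^sub>V x * (sound M Vapor x)\<^sup>2 \<le> v\<^sub>V x * (x * v\<^sub>V x)"
    using va by (intro mult_left_mono) auto
  then have "v\<^sub>V x + x * dvol Vapor x \<le> 0"
    using va by (simp add: dvol_def field_simps power2_eq_square)
  then have "(v\<^sub>V x + x * dvol Vapor x) * (psat M - p) \<le> 0"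
    using less by (intro mult_nonpos_nonneg) auto
  then show ?thesis using eq by simp
qed simp

lemma gibbs_vapor_le:
  assumes "0 < p" "p < psat M"
  shows "g\<^sub>V p \<le> g\<^sub>V (psat M) + psat M * v\<^sub>V (psat M) * (ln p - ln (psat M))"
proof -
  define c where "c = psat M * v\<^sub>V (psat M)"
  have dom: "p \<in> dom_of M Vapor" using assms by simp
  have "((\<lambda>x. g\<^sub>V x - c * ln x) has_real_derivative v\<^sub>V x - c / x) (at x within dom_of M Vapor)"
    if "p \<le> x" for x
    using gibbs_deriv[OF dom_of_upward[OF dom that]] that assms(1)
    by (auto intro!: derivative_eq_intros)
  from mvt_dom_of[OF dom assms(2) this] obtain x where x: "p < x" "x < psat M"
    and eq: "(g\<^sub>V (psat M) - c * ln (psat M)) - (g\<^sub>V p - c * ln p) = (v\<^sub>V x - c / x) * (psat M - p)"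
    by metis
  have "c / x \<le> v\<^sub>V x"
    using pressure_times_vol_vapor_ge[of x] x assms by (simp add: c_def field_simps)
  then have "(v\<^sub>V x - c / x) * (psat M - p) \<ge> 0" using assms by simp
  then show ?thesis using eq unfolding c_def[symmetric] by (simp add: algebra_simps)
qed

text \<open>Bounds the liquid Gibbs energy below independently of the vapor pressure.\<close>

lemma gibbs_liquid_mono:
  assumes "0 < q"
  shows "g\<^sub>L 0 \<le> g\<^sub>L q"
proof -
  have dom: "0 \<in> dom_of M Liquid" using pmin_nonpos by simp
  obtain x where "0 < x" "g\<^sub>L q - g\<^sub>L 0 = v\<^sub>L x * (q - 0)"
    using mvt_dom_of[OF dom assms gibbs_deriv[OF dom_of_upward[OF dom]]] by metis
  moreover from this have "v\<^sub>L x * (q - 0) > 0" using vol_pos[OF pos_in_dom_of] assms by simp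
  ultimately show ?thesis by linarith
qed

text \<open>If the jump term stayed bounded as \<open>p\<close> tends to 0, then \<open>z v\<^sub>V\<close> would stay bounded as well, but
  \<open>z v\<^sub>V = (p v\<^sub>V) h\<close> with \<open>p v\<^sub>V\<close> bounded below and \<open>h\<close> at least of the order of \<open>- g\<^sub>V(p)\<close>.\<close>

lemma velocity_jump_unbounded:
  assumes "K \<ge> 0"
  obtains p where "0 < p" "p < psat M" "5 * v\<^sub>L (pmin M) \<le> v\<^sub>V p"
    and "K < (liquid_pressure p - p) * (v\<^sub>V p - v\<^sub>L (liquid_pressure p))"
proof -
  define c where "c = psat M * v\<^sub>V (psat M)"
  have c: "c > 0" using psat_pos vol_pos[of "psat M" Vapor] by (simp add: c_def)
  \<comment> \<open>\<open>E\<close> is such that \<open>h_fun M p q > tau M * E\<close> forces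
    \<open>z * v\<^sub>V p > 2 * sqrt K\<close>; \<open>B\<close> is the bound on
    \<open>ln p\<close> that ensures this lower bound on \<open>h_fun\<close>.\<close>
  define E where "E = 2 * sqrt K / (c * tau M)"
  define B where "B = ln (psat M) + (g\<^sub>L 0 - g\<^sub>V (psat M) - K - E) / c"
  have "\<forall>\<^sub>F p in at_right 0. ln p < B"
    using ln_at_0 by (auto simp: filterlim_at_bot_dense)
  \<comment> \<open>Here a factor 3 would do; 5 makes \<open>v\<^sub>L (pmin M)\<close> at most a
    quarter of the volume jump, as the comparison with the wave functions requires.\<close>
  moreover have "\<forall>\<^sub>F p in at_right 0. 5 * v\<^sub>L (pmin M) \<le> v\<^sub>V p"
    using vol_vapor_at_top by (auto simp: filterlim_at_top)
  moreover have "\<forall>\<^sub>F p in at_right 0. p \<in> {0<..<psat M}"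
    using psat_pos eventually_at_right_real by auto
  ultimately have "\<forall>\<^sub>F p in at_right 0. ln p < B \<and> 5 * v\<^sub>L (pmin M) \<le> v\<^sub>V p \<and> p \<in> {0<..<psat M}"
    by (intro eventually_conj)
  then obtain p where lnp: "ln p < B" and V5: "5 * v\<^sub>L (pmin M) \<le> v\<^sub>V p" and p: "0 < p" "p < psat M"
    using eventually_happens'[of "at_right (0::real)"] trivial_limit_at_right_real by auto
  define q where "q = liquid_pressure p"
  define z where "z = evaporation_flux p"
  have pq: "p < q" using liquid_pressure_gt[OF p] by (simp add: q_def)
  have vq: "v\<^sub>L q \<le> v\<^sub>L (pmin M)" "v\<^sub>L q > 0"
    using vol_antimono[of "pmin M" Liquid q] pos_ge_pmin[of q] p pq vol_pos[OF pos_in_dom_of, of q]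
    by auto
  have "K < (q - p) * (v\<^sub>V p - v\<^sub>L q)"
  proof (rule ccontr)
    assume "\<not> ?thesis"
    then have R: "(q - p) * (v\<^sub>V p - v\<^sub>L q) \<le> K" by simp
    have "z * (v\<^sub>V p - v\<^sub>L q) \<le> sqrt K"
      using evaporation_flux_eq(3)[of p] p R by (simp add: z_def q_def)
    moreover have "z * (v\<^sub>V p / 2) \<le> z * (v\<^sub>V p - v\<^sub>L q)"
      using evaporation_flux_pos[OF p] vq V5 by (intro mult_left_mono) (auto simp: z_def)
    ultimately have zV: "z * v\<^sub>V p \<le> 2 * sqrt K" by simp
    have "(q - p) * ((v\<^sub>L q + v\<^sub>V p) / 2) \<le> (q - p) * (v\<^sub>V p - v\<^sub>L q)"
      using pq vq V5 by (intro mult_left_mono) auto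
    then have "(q - p) * (v\<^sub>L q + v\<^sub>V p) / 2 \<le> K" using R by simp
    moreover have "g\<^sub>L 0 \<le> g\<^sub>L q" using gibbs_liquid_mono p pq by simp
    moreover have "g\<^sub>V p \<le> g\<^sub>V (psat M) + c * (ln p - ln (psat M))"
      using gibbs_vapor_le[OF p] by (simp add: c_def)
    moreover have "c * (ln p - ln (psat M)) < g\<^sub>L 0 - g\<^sub>V (psat M) - K - E"
      using lnp c by (simp add: B_def field_simps)
    ultimately have "E < g\<^sub>L q - g\<^sub>V p - (q - p) * (v\<^sub>L q + v\<^sub>V p) / 2" by linarith
    then have h: "tau M * E < h_fun M p q" using tau_pos by (simp add: h_fun_def)
    have "E \<ge> 0" using c tau_pos assms by (simp add: E_def)
    then have h0: "h_fun M p q \<ge> 0"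
      using h tau_pos by (meson less_imp_le mult_nonneg_nonneg order_trans)
    have "2 * sqrt K = c * (tau M * E)" using c tau_pos by (simp add: E_def)
    also have "\<dots> < c * h_fun M p q" using h c by simp
    also have "\<dots> \<le> (p * v\<^sub>V p) * h_fun M p q"
      using pressure_times_vol_vapor_ge[of p] p h0 by (intro mult_right_mono) (auto simp: c_def)
    also have "\<dots> = z * v\<^sub>V p" by (simp add: z_def evaporation_flux_def q_def)
    finally show False using zV by simp
  qed
  then show ?thesis using that p V5 by (simp add: q_def)
qed

section \<open>A root of the transition function\<close>

lemma transition_root_exists:
  assumes pm: "pmin M \<le> pm" and pp: "pmin M \<le> pp" and cav: "cavitation_criterion M pm um pp up"
  obtains p where "0 < p" "p < psat M"
    "wave_fun M pm (liquid_pressure p) + wave_fun M pp (liquid_pressure p)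
      - 2 * (evaporation_flux p * (v\<^sub>V p - v\<^sub>L (liquid_pressure p))) + up - um = 0"
proof -
  let ?F = "\<lambda>q. wave_fun M pm q + wave_fun M pp q + up - um"
  let ?T = "\<lambda>p. ?F (liquid_pressure p)
    - 2 * sqrt ((liquid_pressure p - p) * (v\<^sub>V p - v\<^sub>L (liquid_pressure p)))"
  have no_root: "?F q \<noteq> 0" if "pmin M \<le> q" for q
    using cav that unfolding cavitation_criterion_def by blast
  have F_cont: "continuous_on {0<..} ?F"
    by (intro continuous_intros continuous_on_wave_fun pm pp)
  have T_psat: "?T (psat M) > 0"
  proof (rule ccontr)
    assume "\<not> ?thesis"
    then have "?F (psat M) \<le> 0" by (simp add: liquid_pressure_psat)
    have "filterlim (\<lambda>q. wave_fun M pm q + wave_fun M pp q) at_top at_top"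
      by (intro filterlim_at_top_add_at_top wave_fun_at_top pm pp)
    then have "\<forall>\<^sub>F q in at_top. um - up \<le> wave_fun M pm q + wave_fun M pp q \<and> psat M \<le> q"
      by (intro eventually_conj eventually_ge_at_top) (simp add: filterlim_at_top)
    then obtain b where b: "um - up \<le> wave_fun M pm b + wave_fun M pp b" "psat M \<le> b"
      using eventually_happens'[OF trivial_limit_at_top_linorder] by blast
    have "continuous_on {psat M..b} ?F"
      using psat_pos by (intro continuous_on_subset[OF F_cont]) auto
    with IVT'[of ?F "psat M" 0 b] \<open>?F (psat M) \<le> 0\<close> b obtain q where "psat M \<le> q" "?F q = 0"
      by auto
    then show False using no_root[of q] psat_pos pmin_nonpos by simp
  qed
  define v where "v = v\<^sub>L (pmin M)"
  \<comment> \<open>\<open>C\<close> collects what remains of the bound on \<open>?F q\<close> once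
    the part growing with \<open>q\<close> is absorbed into \<open>r\<close>.\<close>
  define C where "C = 2 * sqrt ((psat M - pmin M) * v) + up - um"
  obtain p1 where p1: "0 < p1" "p1 < psat M" "5 * v \<le> v\<^sub>V p1"
    and R: "C\<^sup>2 < (liquid_pressure p1 - p1) * (v\<^sub>V p1 - v\<^sub>L (liquid_pressure p1))"
    unfolding v_def by (rule velocity_jump_unbounded[of "C\<^sup>2"]) auto
  define q where "q = liquid_pressure p1"
  define r where "r = sqrt ((q - p1) * (v\<^sub>V p1 - v\<^sub>L q))"
  have pq: "p1 < q" using liquid_pressure_gt p1 by (simp add: q_def)
  have v0: "v > 0" using vol_pos[of "pmin M" Liquid] by (simp add: v_def)
  have vq: "v\<^sub>L q \<le> v"
    using vol_antimono[of "pmin M" Liquid q] pos_ge_pmin[of q] p1 pq by (simp add: v_def)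
  have qm: "pmin M \<le> q" using pos_ge_pmin[of q] p1 pq by simp
  have "sqrt ((q - pmin M) * v) \<le> sqrt ((q - p1) * v + (psat M - pmin M) * v)"
    using p1 v0 by (intro real_sqrt_le_mono) (simp add: algebra_simps)
  also have "\<dots> \<le> sqrt ((q - p1) * v) + sqrt ((psat M - pmin M) * v)"
    using p1 pq v0 psat_pos pmin_nonpos by (intro sqrt_add_le_add_sqrt) auto
  \<comment> \<open>By the factor 5, \<open>v\<close> is at most a quarter of the volume jump. So
    the growing parts of the two waves add up to at most \<open>r\<close>, against
    \<open>2 * r\<close> from the phase boundaries.\<close>
  also have "sqrt ((q - p1) * v) \<le> sqrt ((q - p1) * (v\<^sub>V p1 - v\<^sub>L q) / 4)"
    using pq vq p1 by (intro real_sqrt_le_mono) (simp add: mult_left_mono)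
  also have "\<dots> = r / 2" by (simp add: r_def real_sqrt_divide)
  finally have "sqrt ((q - pmin M) * v) \<le> r / 2 + sqrt ((psat M - pmin M) * v)" by simp
  moreover have "wave_fun M pm q \<le> sqrt ((q - pmin M) * v)" "wave_fun M pp q \<le> sqrt ((q - pmin M) * v)"
    using wave_fun_le[OF qm] pm pp by (auto simp: v_def)
  moreover have "C < r"
    using R real_less_rsqrt[of C] by (simp add: r_def q_def)
  ultimately have "?F q - 2 * r \<le> 0" unfolding C_def by linarith
  then have T_p1: "?T p1 \<le> 0" unfolding r_def q_def .
  have sub: "{p1..psat M} \<subseteq> {0<..psat M}" using p1 by auto
  have lp_cont: "continuous_on {p1..psat M} liquid_pressure"
    by (rule continuous_on_subset[OF continuous_on_liquid_pressure sub])
  have lp_pos: "liquid_pressure p > 0" if "p \<in> {p1..psat M}" for p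
    using that liquid_pressure(1)[of p] p1 by simp
  have "continuous_on {p1..psat M} (\<lambda>p. v\<^sub>L (liquid_pressure p))"
    by (rule continuous_on_vol_compose[OF lp_cont])
       (use lp_pos pos_in_dom_of in \<open>auto simp del: dom_of.simps\<close>)
  moreover have "continuous_on {p1..psat M} v\<^sub>V"
    by (rule continuous_on_subset[OF continuous_on_vol]) (use p1 in auto)
  ultimately have "continuous_on {p1..psat M}
      (\<lambda>p. 2 * sqrt ((liquid_pressure p - p) * (v\<^sub>V p - v\<^sub>L (liquid_pressure p))))"
    using lp_cont by (intro continuous_intros)
  moreover have "continuous_on {p1..psat M} (\<lambda>p. ?F (liquid_pressure p))"
    by (rule continuous_on_compose2[OF F_cont lp_cont]) (use lp_pos in auto)
  ultimately have "continuous_on {p1..psat M} ?T" by (rule continuous_on_diff[rotated])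
  from IVT'[of ?T p1 0 "psat M", OF T_p1 less_imp_le[OF T_psat] less_imp_le[OF p1(2)] this]
  obtain p where p: "p1 \<le> p" "p \<le> psat M" "?T p = 0" by blast
  then have "p \<noteq> psat M" using T_psat by auto
  then have "0 < p" "p < psat M" using p p1 by auto
  then show ?thesis
    using that[of p] p(3) evaporation_flux_eq(3)[of p] by simp
qed

section \<open>Assembly of the wave pattern\<close>

lemma right_half_solution:
  assumes p: "0 < p" "p < psat M" and "pmin M \<le> pr"
  defines "q \<equiv> liquid_pressure p" and "z \<equiv> evaporation_flux p"
  assumes u: "uv + z * (v\<^sub>V p - v\<^sub>L q) = ur + wave_fun M pr q"
  shows "\<exists>prof s s'. uv + z * v\<^sub>V p < s \<and> s \<le> s' \<and>
    vapor_liquid_boundary M (uv + z * v\<^sub>V p) (Vapor, p, uv) (Liquid, q, uv + z * (v\<^sub>V p - v\<^sub>L q)) \<and>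
    (\<forall>U. (\<forall>\<xi>\<in>{s..s'}. U \<xi> = prof \<xi>) \<longrightarrow>
      classical_wave M U s s' (Liquid, q, uv + z * (v\<^sub>V p - v\<^sub>L q)) (Liquid, pr, ur))"
proof -
  let ?V = "(Vapor, p, uv)" and ?L = "(Liquid, q, uv + z * (v\<^sub>V p - v\<^sub>L q))"
  \<comment> \<open>The speed at which the flux through the front, seen from the vapor, equals
    \<open>z\<close>. The hypothesis on \<open>uv\<close> matches the liquid velocity behind the
    boundary with that of the classical wave.\<close>
  define W where "W = uv + z * v\<^sub>V p"
  have pq: "p < q" using liquid_pressure_gt[OF p] by (simp add: q_def)
  have qm: "pmin M < q" using pq p pmin_nonpos by simp
  have z: "z > 0" using evaporation_flux_pos[OF p] by (simp add: z_def)
  have z2: "z\<^sup>2 * (v\<^sub>V p - v\<^sub>L q) = q - p"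
    using evaporation_flux_eq(2)[of p] p by (simp add: z_def q_def)
  have v: "v\<^sub>V p > 0" "v\<^sub>L q > 0"
    using vol_pos[of p Vapor] vol_pos[of q Liquid] p qm by auto
  have flux: "mass_flux M W ?V = z" "mass_flux M W ?L = z"
    using v by (auto simp: mass_flux_def W_def field_simps)
  \<comment> \<open>The momentum balance turns the difference of kinetic energies into the
    trapezoidal term of \<open>h_fun\<close>.\<close>
  have energy: "front_energy M W ?L - front_energy M W ?V = h_fun M p q / tau M"
  proof -
    have "(z * v\<^sub>L q)\<^sup>2 - (z * v\<^sub>V p)\<^sup>2 = - ((z\<^sup>2 * (v\<^sub>V p - v\<^sub>L q)) * (v\<^sub>L q + v\<^sub>V p))"
      by (simp add: power2_eq_square algebra_simps)
    then have "(z * v\<^sub>L q)\<^sup>2 - (z * v\<^sub>V p)\<^sup>2 = - ((q - p) * (v\<^sub>L q + v\<^sub>V p))"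
      unfolding z2 .
    moreover have "front_energy M W ?L = g\<^sub>L q + (z * v\<^sub>L q)\<^sup>2 / 2"
      "front_energy M W ?V = g\<^sub>V p + (z * v\<^sub>V p)\<^sup>2 / 2"
      by (simp_all add: front_energy_def W_def algebra_simps)
    moreover have "h_fun M p q / tau M = g\<^sub>L q - g\<^sub>V p - (q - p) * (v\<^sub>L q + v\<^sub>V p) / 2"
      using tau_pos by (simp add: h_fun_def)
    ultimately show ?thesis by linarith
  qed
  have rate: "transition_rate M W ?V ?L = z"
    unfolding transition_rate_def energy using tau_pos
    by (simp add: z_def evaporation_flux_def q_def)
  \<comment> \<open>The sign of \<open>h_fun\<close> is read off from \<open>z > 0\<close>; it gives
    the entropy inequality.\<close>
  have "tau M * p * (h_fun M p q / tau M) = z"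
    using rate unfolding transition_rate_def energy by simp
  then have "h_fun M p q / tau M > 0"
    using z tau_pos p by (metis mult_pos_pos zero_less_mult_pos)
  then have "z * (h_fun M p q / tau M) \<ge> 0" using z by (intro mult_nonneg_nonneg) auto
  then have "jump_conditions M W ?V ?L"
    unfolding jump_conditions_def flux energy using z2
    by (simp add: power2_eq_square mult.assoc)
  moreover have "rate_admissible M W ?V ?L"
    using interface_pressure_liquid_pressure[OF p]
    unfolding rate_admissible_def rate interface_pressure_def
    by (simp add: z_def evaporation_flux_def q_def)
  ultimately have "vapor_liquid_boundary M W ?V ?L"
    unfolding vapor_liquid_boundary_def using flux rate p qm by (simp add: is_state_def)
  moreover have "\<exists>prof s s'. ur + wave_fun M pr q + z * v\<^sub>L q < s \<and> s \<le> s' \<and>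
      (\<forall>U. (\<forall>\<xi>\<in>{s..s'}. U \<xi> = prof \<xi>) \<longrightarrow>
        classical_wave M U s s' (Liquid, q, ur + wave_fun M pr q) (Liquid, pr, ur))"
    using evaporation_flux_subsonic[OF p] evaporation_flux_less_chord[OF p, of pr] qm z assms(3)
    by (intro liquid_wave_exists) (auto simp: q_def z_def)
  moreover have "ur + wave_fun M pr q + z * v\<^sub>L q = W"
    unfolding u[symmetric] W_def by (simp add: algebra_simps)
  ultimately show ?thesis unfolding u[symmetric] W_def by simp
qed

lemma phase_transition_solution_exists:
  assumes p: "0 < p" "p < psat M" and "pmin M \<le> pl" "pmin M \<le> pr"
    and root: "wave_fun M pl (liquid_pressure p) + wave_fun M pr (liquid_pressure p)
      - 2 * (evaporation_flux p * (v\<^sub>V p - v\<^sub>L (liquid_pressure p))) + ur - ul = 0"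
  shows "\<exists>U uv. phase_transition_solution M U (Liquid, pl, ul) (Vapor, p, uv) (Liquid, pr, ur)"
proof -
  define q where "q = liquid_pressure p"
  define z where "z = evaporation_flux p"
  define j where "j = z * (v\<^sub>V p - v\<^sub>L q)"
  \<comment> \<open>This choice makes the left matching condition an identity; the root equation is
    then the right one.\<close>
  define uv where "uv = ul - wave_fun M pl q + j"
  define w where "w = z * v\<^sub>V p"
  have "uv + j = ur + wave_fun M pr q"
    using root by (simp add: uv_def j_def z_def q_def)
  from right_half_solution[OF p assms(4) this[unfolded j_def z_def q_def]]
  obtain prof_r r r' where r: "uv + w < r" "r \<le> r'"
    and r_boundary: "vapor_liquid_boundary M (uv + w) (Vapor, p, uv) (Liquid, q, uv + j)"
    and r_wave: "\<And>U. \<forall>\<xi>\<in>{r..r'}. U \<xi> = prof_r \<xi> \<Longrightarrow>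
      classical_wave M U r r' (Liquid, q, uv + j) (Liquid, pr, ur)"
    unfolding j_def w_def z_def q_def by blast
  \<comment> \<open>The left half is constructed as a right half for the reflected data, with all
    velocities negated.\<close>
  have "- uv + j = - ul + wave_fun M pl q" by (simp add: uv_def)
  from right_half_solution[OF p assms(3) this[unfolded j_def z_def q_def]]
  obtain prof_l l l' where l: "- uv + w < l" "l \<le> l'"
    and l_boundary: "vapor_liquid_boundary M (- uv + w) (Vapor, p, - uv) (Liquid, q, - uv + j)"
    and l_wave: "\<And>U. \<forall>\<xi>\<in>{l..l'}. U \<xi> = prof_l \<xi> \<Longrightarrow>
      classical_wave M U l l' (Liquid, q, - uv + j) (Liquid, pl, - ul)"
    unfolding j_def w_def z_def q_def by blast
  \<comment> \<open>This separates the two phase boundaries, which move at \<open>uv - w\<close> and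
    \<open>uv + w\<close>.\<close>
  have "w > 0"
    using evaporation_flux_pos[OF p] vol_pos[of p Vapor] p by (simp add: w_def z_def)
  \<comment> \<open>The wave intervals include both endpoints, since a rarefaction prescribes its
    end states there.\<close>
  define U where "U \<xi> =
    (if \<xi> < - l' then (Liquid, pl, ul)
     else if \<xi> \<le> - l then mirror (prof_l (- \<xi>))
     else if \<xi> < uv - w then (Liquid, q, uv - j)
     else if \<xi> < uv + w then (Vapor, p, uv)
     else if \<xi> < r then (Liquid, q, uv + j)
     else if \<xi> \<le> r' then prof_r \<xi>
     else (Liquid, pr, ur))" for \<xi>
  have "\<forall>\<xi>\<in>{l..l'}. mirror (U (- \<xi>)) = prof_l \<xi>" by (simp add: U_def)
  from classical_wave_mirror[OF l_wave[OF this]]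
  have left_wave: "classical_wave M U (- l') (- l) (Liquid, pl, ul) (Liquid, q, uv - j)" by simp
  have left_boundary: "liquid_vapor_boundary M (uv - w) (Liquid, q, uv - j) (Vapor, p, uv)"
    using liquid_vapor_boundary_mirror[OF l_boundary] by simp
  have right_wave: "classical_wave M U r r' (Liquid, q, uv + j) (Liquid, pr, ur)"
    by (rule r_wave) (use l r \<open>w > 0\<close> in \<open>auto simp: U_def\<close>)
  have "phase_transition_solution M U (Liquid, pl, ul) (Vapor, p, uv) (Liquid, pr, ur)"
    unfolding phase_transition_solution_def
    by (rule exI[of _ "- l'"], rule exI[of _ "- l"], rule exI[of _ "uv - w"],
        rule exI[of _ "uv + w"], rule exI[of _ r], rule exI[of _ r'],
        rule exI[of _ "(Liquid, q, uv - j)"], rule exI[of _ "(Liquid, q, uv + j)"],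
        intro conjI left_wave left_boundary r_boundary right_wave)
       (use l r \<open>w > 0\<close> in \<open>auto simp: U_def\<close>)
  then show ?thesis by blast
qed

end

theorem theorem5p17:
  fixes M :: two_phase_fluid
    and \<alpha> \<beta> :: real
    and p_Lm u_Lm p_Lp u_Lp :: real
  assumes "thermodynamics M"
    and "structural_assumptions M \<alpha> \<beta>"
    and "p_Lm \<ge> pmin M" and "p_Lp \<ge> pmin M"
    and "cavitation_criterion M p_Lm u_Lm p_Lp u_Lp"
  shows "\<exists>U p_V u_V.
    phase_transition_solution M U (Liquid, p_Lm, u_Lm) (Vapor, p_V, u_V) (Liquid, p_Lp, u_Lp) \<and>
    0 < p_V \<and> p_V \<le> sigma_max \<alpha> * psat M \<and>
    ((\<exists>!q. interface_pressure M p_V q) \<longrightarrow> transition_fun M p_Lm u_Lm p_Lp u_Lp p_V = 0)"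
proof -
  interpret structured_fluid M \<alpha> \<beta>
    using assms(1,2) by unfold_locales
  obtain p where p: "0 < p" "p < psat M"
    and root: "wave_fun M p_Lm (liquid_pressure p) + wave_fun M p_Lp (liquid_pressure p)
      - 2 * (evaporation_flux p * (vol M Vapor p - vol M Liquid (liquid_pressure p))) + u_Lp - u_Lm = 0"
    by (rule transition_root_exists[OF assms(3-5)])
  obtain U u_V where
    "phase_transition_solution M U (Liquid, p_Lm, u_Lm) (Vapor, p, u_V) (Liquid, p_Lp, u_Lp)"
    using phase_transition_solution_exists[OF p assms(3,4) root] by blast
  \<comment> \<open>Uniqueness identifies \<open>phi\<close> with the constructed branch. The sign
    of the jump term changes because \<open>transition_fun\<close> uses liquid minus vapor
    volume.\<close>
  moreover have "transition_fun M p_Lm u_Lm p_Lp u_Lp p = 0" if "\<exists>!q. interface_pressure M p q"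
  proof -
    have "phi M p = liquid_pressure p"
      unfolding phi_def by (rule the1_equality[OF that interface_pressure_liquid_pressure[OF p]])
    then show ?thesis
      using root by (simp add: transition_fun_def z_fun_def evaporation_flux_def algebra_simps)
  qed
  moreover have "p \<le> sigma_max \<alpha> * psat M" using le_psat_imp_le_sigma_max[of p] p by simp
  ultimately show ?thesis using p(1) by blast
qed

end
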